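(* Let $S=\{a_1,a_2,\dots,a_n\}$ be a finite set of non-zero integers, let $3\le d_1\le\dots\le d_k$ be integers, and let $d=\mathrm{lcm}(d_1,\dots,d_k)$; assume $8\mid d$. Let $\mathbb{L}=\mathbb{Q}(\sqrt{a_1},\dots,\sqrt{a_n},\zeta_{d_1},\dots,\zeta_{d_k})$, where $\zeta_{d_i}$ denotes a primitive $d_i$-th root of unity for $i=1,\dots,k$. Then there is an explicit isomorphism between $\mathbf{D}_0(S)$, formed with this $d$, and $\mathrm{Gal}(\mathbb{L}/\mathbb{Q})$.
   Context: For a non-zero integer $m$, $\mathrm{sqf}(m)$ is its squarefree part: the unique squarefree integer $s$ (of the same sign as $m$) with $m=sk^2$ for some integer $k$. For a finite set $T$ of non-zero integers, $\mathrm{sqf}(T)=\mathrm{sqf}\left(\prod_{s\in T}s\right)$, and $\mathrm{sqf}(\emptyset)=1$. Let $\mathcal{D}_0=\{T\subseteq S:\mathrm{sqf}(T)\mid d\}$. $\mathbf{F}(S)$ is the group, under pointwise multiplication, of all maps $\theta:S\to\{-1,1\}$; for $T\subseteq S$, $\theta(T)=\prod_{s\in T}\theta(s)$, with $\theta(\emptyset)=1$. $\mathbb{Z}_d^*=\{1\le f<d:(f,d)=1\}$ is the group of units modulo $d$. $\left(\frac{\cdot}{f}\right)$ is the Jacobi symbol. Define $$\mathbf{D}_0(S)=\left\{(f,\theta)\in\mathbb{Z}_d^*\times\mathbf{F}(S):\theta(T)\left(\frac{\mathrm{sqf}(T)}{f}\right)=1\ \text{for all } T\in\mathcal{D}_0\right\},$$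 a subgroup of the direct product $\mathbb{Z}_d^*\times\mathbf{F}(S)$. *)

theory Defs
  imports
    Complex_Main
    "HOL-Algebra.Algebra"
    "HOL-Algebra.Algebraic_Closure_Type"
    "HOL-Computational_Algebra.Squarefree"
    "HOL-Number_Theory.Number_Theory"
begin

text \<open>
  On non-zero integers the library's \<open>squarefree_part\<close> keeps the sign, since it is the quotient
  of the argument by its largest square divisor. It is therefore the signed squarefree part:
\<close>

lemma squarefree_part_int_characterization:
  fixes m s :: int
  assumes "m \<noteq> 0"
  shows "s = squarefree_part m \<longleftrightarrow> squarefree s \<and> sgn s = sgn m \<and> (\<exists>k. m = s * k\<^sup>2)"
proof
  assume s: "s = squarefree_part m"
  have dec: "m = s * (square_part m)\<^sup>2"
    unfolding s by (rule squarefree_decompose)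
  have "square_part m \<noteq> 0"
    using dec assms by auto
  moreover have "sgn m = sgn s * sgn ((square_part m)\<^sup>2)"
    by (metis dec sgn_mult)
  ultimately have "sgn m = sgn s"
    by (metis mult.right_neutral sgn_pos zero_less_power2)
  with dec show "squarefree s \<and> sgn s = sgn m \<and> (\<exists>k. m = s * k\<^sup>2)"
    unfolding s by (metis squarefree_squarefree_part)
next
  assume *: "squarefree s \<and> sgn s = sgn m \<and> (\<exists>k. m = s * k\<^sup>2)"
  then obtain k where k: "m = s * k\<^sup>2" by blast
  define t where "t = squarefree_part m"
  have dec: "m = t * (square_part m)\<^sup>2"
    unfolding t_def by (rule squarefree_decompose)
  have nz: "square_part m \<noteq> 0" "k \<noteq> 0" "s \<noteq> 0" "t \<noteq> 0"
    using dec k assms by auto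
  have mult: "multiplicity p s = multiplicity p t" if p: "Factorial_Ring.prime p" for p
  proof -
    have "multiplicity p m = multiplicity p s + 2 * multiplicity p k"
      using p nz unfolding k
      by (subst prime_elem_multiplicity_mult_distrib)
         (auto simp: prime_elem_multiplicity_power_distrib)
    moreover have "multiplicity p s \<le> 1"
      using * p nz squarefree_factorial_semiring''[of s] by auto
    ultimately have "multiplicity p s = multiplicity p m mod 2"
      by presburger
    thus ?thesis
      using p by (simp add: t_def prime_multiplicity_squarefree_part)
  qed
  have "normalize s = normalize t"
    using nz mult by (intro multiplicity_eq_imp_eq) auto
  hence "\<bar>s\<bar> = \<bar>t\<bar>" by simp
  moreover have "sgn t = sgn m"
    using nz dec by (metis mult.right_neutral sgn_mult sgn_pos zero_less_power2)
  ultimately show "s = squarefree_part m"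
    using * unfolding t_def by (metis mult_sgn_abs)
qed

definition sqf_set :: "int set \<Rightarrow> int" where
  "sqf_set T = squarefree_part (\<Prod>s\<in>T. s)"

text \<open>Only meaningful for odd positive \<open>f\<close>; factors are repeated according to multiplicity.\<close>

definition Jacobi :: "int \<Rightarrow> int \<Rightarrow> int" where
  "Jacobi m f = (\<Prod>p\<in>#prime_factorization f. Legendre m p)"

text \<open>The functions in the carrier are extensional, i.e. \<open>undefined\<close> outside \<open>S\<close>.\<close>

definition F_group :: "int set \<Rightarrow> (int \<Rightarrow> int) monoid" where
  "F_group S = product_group S (\<lambda>_. sign_img)"

definition D0_sets :: "nat \<Rightarrow> int set \<Rightarrow> int set set" where
  "D0_sets d S = {T. T \<subseteq> S \<and> sqf_set T dvd int d}"

text \<open>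
  For \<open>d > 1\<close> the carrier of \<open>units_of (residue_ring (int d))\<close> consists of the integers \<open>f\<close>
  with \<open>0 < f < d\<close> coprime to \<open>d\<close>; see \<open>residues.res_units_eq\<close>.
\<close>

definition D0_group :: "nat \<Rightarrow> int set \<Rightarrow> (int \<times> (int \<Rightarrow> int)) monoid" where
  "D0_group d S =
     (let G = units_of (residue_ring (int d)) \<times>\<times> F_group S in
      G\<lparr>carrier := {(f, \<theta>) \<in> carrier G.
          \<forall>T\<in>D0_sets d S. (\<Prod>s\<in>T. \<theta> s) * Jacobi (sqf_set T) f = 1}\<rparr>)"

definition primitive_root_of_unity :: "nat \<Rightarrow> complex \<Rightarrow> bool" where
  "primitive_root_of_unity n z \<longleftrightarrow> 0 < n \<and> z ^ n = 1 \<and> (\<forall>m. 0 < m \<and> m < n \<longrightarrow> z ^ m \<noteq> 1)"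

definition rat_adjoin :: "complex set \<Rightarrow> complex ring" where
  "rat_adjoin A = ring_of_type_algebra\<lparr>carrier := generate_field ring_of_type_algebra (\<rat> \<union> A)\<rparr>"

text \<open>
  As for \<open>AutoGroup\<close>, automorphisms are extensional functions, so that equal automorphisms
  are equal as HOL functions; the group operation is composition.
\<close>

definition galois_group :: "('a, 'b) ring_scheme \<Rightarrow> 'a set \<Rightarrow> ('a \<Rightarrow> 'a) monoid" where
  "galois_group L K =
     BijGroup (carrier L)
       \<lparr>carrier := {\<sigma> \<in> ring_iso L L \<inter> Bij (carrier L). \<forall>x\<in>K. \<sigma> x = x}\<rparr>"

end

theory Submission
  imports Defs
begin

text \<open>
  Let \<open>z\<close> be a primitive \<open>d\<close>-th root of unity, so that the field in question is
  \<open>\<rat>(z)(\<surd>a : a \<in> S)\<close>. For \<open>f\<close> coprime to \<open>d\<close>, irreducibility of the cyclotomic polynomial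
  makes \<open>z \<mapsto> z ^ f\<close> an automorphism of \<open>\<rat>(z)\<close>. Frobenius on \<open>\<int>[z]\<close> and Euler's criterion
  show that it multiplies a square root \<open>\<surd>s \<in> \<int>[z]\<close> by the Jacobi symbol of \<open>s\<close> over \<open>f\<close>.
  As \<open>8\<close> divides \<open>d\<close>, a squarefree \<open>s\<close> has a square root in \<open>\<rat>(z)\<close> iff \<open>s\<close> divides \<open>d\<close>;
  hence \<open>\<D>\<^sub>0\<close> consists of the \<open>T\<close> for which \<open>\<Prod>a\<in>T. \<surd>a\<close> lies in \<open>\<rat>(z)\<close>. These products account
  for all relations of the \<open>\<surd>a\<close> over \<open>\<rat>(z)\<close> by Kummer theory, so a choice of \<open>f\<close> and of signs
  \<open>\<theta>\<close> extends to an automorphism exactly when it respects them, and the automorphism is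
  determined by \<open>(f, \<theta>)\<close>.
\<close>

text \<open>Congruences become equalities because an integer in \<open>q \<int>[z]\<close> is a
  multiple of \<open>q\<close> (\<open>int_dvd_of_ipoly\<close>): for a prime \<open>q\<close> not
  dividing \<open>d\<close>, reduction modulo \<open>q\<close> neither loses a conjugate nor hides a
  sign. Elements of \<open>\<int>[z]\<close> are values \<open>ipoly u z\<close>, and divisibility
  is always an equation between such values, so that no quotient ring is formed.

  Since 8 divides \<open>d\<close>, both -1 and 2 have square roots in \<open>\<int>[z]\<close>.
  Hence signs and the prime 2 need no congruence conditions, and the criterion for \<open>s\<close>
  is plain divisibility.

  The obstacle is that the images of the roots \<open>r a\<close> cannot be prescribed
  independently. If \<open>r a\<close> already lies in the field generated by \<open>z\<close> and
  earlier roots, its image is forced. Kummer theory then yields a set in \<open>D0_sets d S\<close>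
  that consists of \<open>a\<close> and some earlier elements, and the equation imposed on \<theta>
  by this set says precisely that the forced sign is \<open>\<theta> a\<close>. No degree is
  computed: surjectivity of an embedding is seen by exhibiting preimages of the generators.\<close>

section \<open>Values of integer polynomials at complex numbers\<close>

definition ipoly :: "int poly \<Rightarrow> complex \<Rightarrow> complex" where
  "ipoly p x = poly (map_poly of_int p) x"

lemma ipoly_0 [simp]: "ipoly 0 x = 0"
  by (simp add: ipoly_def)

lemma ipoly_pCons [simp]: "ipoly (pCons a p) x = of_int a + x * ipoly p x"
  by (simp add: ipoly_def map_poly_pCons)

lemma ipoly_1 [simp]: "ipoly 1 x = 1"
  by (simp add: one_pCons)

lemma ipoly_add [simp]: "ipoly (p + q) x = ipoly p x + ipoly q x"
  by (induction p q rule: poly_induct2) (auto simp: algebra_simps)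

lemma ipoly_uminus [simp]: "ipoly (- p) x = - ipoly p x"
  by (induction p) (auto simp: algebra_simps)

lemma ipoly_diff [simp]: "ipoly (p - q) x = ipoly p x - ipoly q x"
  using ipoly_add[of p "- q" x] by simp

lemma ipoly_smult [simp]: "ipoly (Polynomial.smult c p) x = of_int c * ipoly p x"
  by (induction p) (auto simp: algebra_simps)

lemma ipoly_mult [simp]: "ipoly (p * q) x = ipoly p x * ipoly q x"
  by (induction p) (auto simp: algebra_simps)

lemma ipoly_power [simp]: "ipoly (p ^ n) x = ipoly p x ^ n"
  by (induction n) auto

lemma ipoly_monom [simp]: "ipoly (Polynomial.monom c n) x = of_int c * x ^ n"
  by (induction n) (auto simp: monom_Suc Polynomial.monom_0)

lemma ipoly_of_nat [simp]: "ipoly (of_nat n) x = of_nat n"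
  by (induction n) auto

lemma ipoly_pcompose [simp]: "ipoly (p \<circ>\<^sub>p q) x = ipoly p (ipoly q x)"
  by (induction p) (auto simp: pcompose_pCons)

section \<open>Frobenius congruences for integer polynomials\<close>

text \<open>Applied in \<int> to derive Fermat's congruence and in \<open>\<int>[X]\<close> to
  derive the Frobenius congruence, hence the general ring.\<close>

lemma freshman_dvd:
  fixes a b :: "'a :: comm_ring_1"
  assumes "Factorial_Ring.prime q"
  shows "of_nat q dvd (a + b) ^ q - (a ^ q + b ^ q)"
proof -
  have q: "q \<ge> 1" using assms prime_ge_1_nat by blast
  have "(a + b) ^ q = (\<Sum>k\<le>q. of_nat (q choose k) * a ^ k * b ^ (q - k))"
    by (rule binomial_ring)
  also have "{..q} = insert 0 (insert q {0<..<q})" using q by auto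
  also have "(\<Sum>k\<in>insert 0 (insert q {0<..<q}). of_nat (q choose k) * a ^ k * b ^ (q - k)) =
    b ^ q + a ^ q + (\<Sum>k\<in>{0<..<q}. of_nat (q choose k) * a ^ k * b ^ (q - k))"
    using q by (simp add: algebra_simps)
  finally have "(a + b) ^ q - (a ^ q + b ^ q) =
    (\<Sum>k\<in>{0<..<q}. of_nat (q choose k) * a ^ k * b ^ (q - k))" by simp
  moreover have "of_nat q dvd (of_nat (q choose k) * a ^ k * b ^ (q - k) :: 'a)" if "k \<in> {0<..<q}" for k
    proof -
    have "q dvd q choose k" using that assms by (intro dvd_choose_prime) auto
    then obtain m where "q choose k = q * m" by blast
    thus ?thesis by (simp add: mult.assoc)
  qed
  ultimately show ?thesis by (auto intro!: dvd_sum)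
qed

lemma fermat_dvd_nat:
  assumes q: "Factorial_Ring.prime q"
  shows "of_nat q dvd (of_nat n ^ q - of_nat n :: int)"
proof (induction n)
  case 0
  have "q > 0" using q prime_gt_0_nat by blast
  thus ?case by (simp add: power_0_left)
next
  case (Suc n)
  have "of_nat q dvd (of_nat n + 1 :: int) ^ q - (of_nat n ^ q + 1 ^ q)"
    by (rule freshman_dvd) fact
  from dvd_add[OF this Suc.IH] show ?case by (simp add: algebra_simps)
qed

lemma fermat_dvd:
  assumes q: "Factorial_Ring.prime q"
  shows "of_nat q dvd (a ^ q - a :: int)"
proof -
  have q0: "q > 0" using q prime_gt_0_nat by blast
  \<comment> \<open>The induction runs over natural numbers; a negative \<open>a\<close> is reached
    through its residue.\<close>
  define n where "n = nat (a mod int q)"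
  have n: "int n = a mod int q" using q0 by (simp add: n_def)
  have "[a ^ q = int n ^ q] (mod int q)" unfolding n by (simp add: cong_def power_mod)
  moreover have "[int n ^ q = int n] (mod int q)"
    using fermat_dvd_nat[OF q, of n] by (simp add: cong_iff_dvd_diff)
  moreover have "[int n = a] (mod int q)" unfolding n by (simp add: cong_def)
  ultimately have "[a ^ q = a] (mod int q)" using cong_trans by blast
  thus ?thesis by (simp add: cong_iff_dvd_diff)
qed

text \<open>The composition is \<open>v(X^q)\<close>. Split off the constant coefficient
  \<open>a\<close>: the errors are the mixed terms of a \<open>q\<close>-th power and
  \<open>a ^ q - a\<close>, both multiples of \<open>q\<close>.\<close>

lemma frobenius_dvd:
  fixes v :: "int poly"
  assumes q: "Factorial_Ring.prime q"
  shows "of_nat q dvd v \<circ>\<^sub>p Polynomial.monom 1 q - v ^ q"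
proof (induction v)
  case 0
  have "q > 0" using q prime_gt_0_nat by blast
  thus ?case by (simp add: power_0_left)
next
  case (pCons a v)
  let ?X = "Polynomial.monom 1 1 :: int poly" and ?Xq = "Polynomial.monom 1 q :: int poly"
  have Xq: "?Xq = ?X ^ q" by (simp add: monom_power)
  have *: "pCons a v = [:a:] + ?X * v" by (simp add: monom_altdef)
  have 1: "of_nat q dvd ([:a:] + ?X * v) ^ q - ([:a:] ^ q + (?X * v) ^ q)"
    by (rule freshman_dvd) fact
  obtain k where k: "a ^ q - a = int q * k" using fermat_dvd[OF q, of a] by auto
  have "[:a:] ^ q - [:a:] = [:a ^ q - a:]" by (simp add: poly_const_pow)
  also have "\<dots> = of_nat q * [:k:]" unfolding k by (simp add: of_nat_poly)
  finally have 2: "of_nat q dvd [:a:] ^ q - [:a:]" by (rule dvdI)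
  have "of_nat q dvd ?X ^ q * (v \<circ>\<^sub>p ?Xq - v ^ q)" using pCons by simp
  hence 3: "of_nat q dvd ?Xq * (v \<circ>\<^sub>p ?Xq) - (?X * v) ^ q"
    by (simp add: Xq power_mult_distrib algebra_simps)
  have "pCons a v \<circ>\<^sub>p ?Xq - pCons a v ^ q = (?Xq * (v \<circ>\<^sub>p ?Xq) - (?X * v) ^ q)
     - (([:a:] + ?X * v) ^ q - ([:a:] ^ q + (?X * v) ^ q)) - ([:a:] ^ q - [:a:])"
    unfolding pcompose_pCons unfolding * by (simp add: algebra_simps)
  thus ?case using dvd_diff[OF dvd_diff[OF 3 1] 2] by simp
qed

lemma frobenius_power_dvd:
  fixes v :: "int poly"
  assumes q: "Factorial_Ring.prime q"
  shows "of_nat q dvd v \<circ>\<^sub>p Polynomial.monom 1 (q ^ n) - v ^ (q ^ n)"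
proof (induction n)
  case 0
  have "v \<circ>\<^sub>p Polynomial.monom 1 1 = v" by (simp add: monom_Suc Polynomial.monom_0 pcompose_idR)
  thus ?case by simp
next
  case (Suc n)
  let ?w = "v \<circ>\<^sub>p Polynomial.monom 1 (q ^ n)"
  have m: "Polynomial.monom 1 (q ^ n) \<circ>\<^sub>p Polynomial.monom 1 q = (Polynomial.monom 1 (q ^ Suc n) :: int poly)"
  proof -
    have X: "Polynomial.monom 1 i = [:0, 1::int:] ^ i" for i by (simp add: monom_altdef)
    have p: "([:0, 1:] ^ i) \<circ>\<^sub>p r = r ^ i" for i and r :: "int poly"
      by (induction i) (auto simp: pcompose_mult pcompose_1 pcompose_pCons)
    show ?thesis unfolding X p by (simp flip: power_mult)
  qed
  have "of_nat q dvd ?w \<circ>\<^sub>p Polynomial.monom 1 q - ?w ^ q" by (rule frobenius_dvd[OF q])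
  moreover have "?w \<circ>\<^sub>p Polynomial.monom 1 q = v \<circ>\<^sub>p Polynomial.monom 1 (q ^ Suc n)"
    by (simp only: m flip: pcompose_assoc)
  \<comment> \<open>A difference divides the difference of \<open>q\<close>-th powers, so the
    induction hypothesis survives raising to the power \<open>q\<close>.\<close>
  moreover have "of_nat q dvd ?w ^ q - (v ^ q ^ n) ^ q"
    unfolding power_diff_sumr2[of ?w q] using Suc.IH by (rule dvd_mult2)
  moreover have "(v ^ q ^ n) ^ q = v ^ (q ^ Suc n)" by (simp add: mult.commute flip: power_mult)
  ultimately show ?case
    using dvd_add[of "of_nat q" "?w \<circ>\<^sub>p Polynomial.monom 1 q - ?w ^ q" "?w ^ q - (v ^ q ^ n) ^ q"] by simp
qed

lemma ipoly_frobenius_power: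
  assumes q: "Factorial_Ring.prime q"
  obtains u where "\<And>x. ipoly v (x ^ (q ^ n)) = ipoly v x ^ (q ^ n) + of_nat q * ipoly u x"
proof -
  obtain u where "v \<circ>\<^sub>p Polynomial.monom 1 (q ^ n) - v ^ (q ^ n) = of_nat q * u"
    using frobenius_power_dvd[OF q, of v n] by auto
  hence u: "v \<circ>\<^sub>p Polynomial.monom 1 (q ^ n) = v ^ (q ^ n) + of_nat q * u" by (simp add: algebra_simps)
  have "ipoly v (x ^ (q ^ n)) = ipoly v x ^ (q ^ n) + of_nat q * ipoly u x" for x
    using arg_cong[OF u, of "\<lambda>p. ipoly p x"] by simp
  thus ?thesis using that by blast
qed

lemma ipoly_frobenius:
  assumes q: "Factorial_Ring.prime q"
  obtains u where "\<And>x. ipoly v (x ^ q) = ipoly v x ^ q + of_nat q * ipoly u x"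
  using ipoly_frobenius_power[OF q, of v 1] by auto

section \<open>Division and minimal polynomials over the integers\<close>

text \<open>Pseudo-division scales \<open>u\<close> by a power of the leading coefficient of
  \<open>h\<close>, which is 1 here.\<close>

lemma monic_division:
  fixes u h :: "int poly"
  assumes "lead_coeff h = 1"
  obtains q r where "u = h * q + r" "r = 0 \<or> Polynomial.degree r < Polynomial.degree h"
proof -
  obtain q r where qr: "pseudo_divmod u h = (q, r)" by fastforce
  have h: "h \<noteq> 0" using assms by auto
  show ?thesis using pseudo_divmod[OF h qr] assms that by simp
qed

text \<open>Gauss' lemma: the primitive part of an annihilating polynomial of least degree divides
  the monic \<open>P\<close> over \<int>, so its leading coefficient is a unit. Being monic,
  \<open>h\<close> permits division with remainder inside \<open>\<int>[X]\<close>.\<close>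

lemma integral_minimal_polynomial:
  assumes P: "lead_coeff P = 1" "ipoly P x = 0"
  obtains h where "lead_coeff h = 1" "ipoly h x = 0" "\<And>u. ipoly u x = 0 \<Longrightarrow> h dvd u"
proof -
  have "\<exists>v. v \<noteq> 0 \<and> ipoly v x = 0" using P by (intro exI[of _ P]) auto
  then obtain v where v: "v \<noteq> 0" "ipoly v x = 0"
    and min: "\<And>u. Polynomial.degree u < Polynomial.degree v \<Longrightarrow> u = 0 \<or> ipoly u x \<noteq> 0"
    using ex_has_least_nat[of "\<lambda>v. v \<noteq> 0 \<and> ipoly v x = 0" _ Polynomial.degree] by (metis not_le)
  define w where "w = primitive_part v"
  have w0: "w \<noteq> 0" and cw: "content w = 1" and dw: "Polynomial.degree w = Polynomial.degree v"
    using v by (auto simp: w_def)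
  have "of_int (content v) * ipoly w x = ipoly v x"
    by (metis content_times_primitive_part ipoly_smult w_def)
  hence wx: "ipoly w x = 0" using v by auto
  obtain a q where aq: "a \<noteq> 0" "Polynomial.smult a P = w * q + pseudo_mod P w"
    using pseudo_mod(1)[OF w0] by blast
  have "ipoly (pseudo_mod P w) x = 0"
    using arg_cong[OF aq(2), of "\<lambda>p. ipoly p x"] wx P by simp
  hence "pseudo_mod P w = 0" using pseudo_mod(2)[OF w0, of P] min dw by metis
  hence aP: "Polynomial.smult a P = w * q" using aq by simp
  have "content P dvd 1" using content_dvd_coeff[of P "Polynomial.degree P"] P by simp
  hence cP: "content P = 1" using is_unit_content_iff by blast
  \<comment> \<open>Both \<open>P\<close> and \<open>w\<close> have content 1, so the scalar brought
    in by pseudo-division is, up to sign, the content of \<open>q\<close> and can be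
    cancelled.\<close>
  have "\<bar>a\<bar> = content q"
    using arg_cong[OF aP, of content] cP cw by (simp add: content_mult)
  hence "a dvd content q" by (metis abs_dvd_iff dvd_refl)
  then obtain q' where q': "q = Polynomial.smult a q'"
    by (auto simp flip: const_poly_dvd_iff_dvd_content)
  have "Polynomial.smult a P = Polynomial.smult a (w * q')" using aP q' by simp
  hence "Polynomial.smult a (P - w * q') = 0" by (simp add: smult_diff_right)
  hence Pw: "P = w * q'" using aq(1) by simp
  have "lead_coeff w * lead_coeff q' = 1" using P(1) unfolding Pw by (simp add: lead_coeff_mult)
  hence lw: "lead_coeff w * lead_coeff w = 1" by (auto simp: zmult_eq_1_iff)
  \<comment> \<open>The leading coefficient of \<open>w\<close> is 1 or -1; multiplying by it makes
    the polynomial monic.\<close>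
  define h where "h = Polynomial.smult (lead_coeff w) w"
  have h1: "lead_coeff h = 1" using lw unfolding h_def by (simp only: lead_coeff_smult)
  have hx: "ipoly h x = 0" using wx by (simp add: h_def)
  have dh: "Polynomial.degree h = Polynomial.degree v"
    using w0 unfolding h_def dw[symmetric] by (simp add: degree_smult_eq)
  have "h dvd u" if u: "ipoly u x = 0" for u
  proof -
    obtain q r where qr: "u = h * q + r" "r = 0 \<or> Polynomial.degree r < Polynomial.degree h"
      using monic_division[OF h1] by blast
    have "ipoly r x = 0" using u hx unfolding qr(1) by simp
    hence "r = 0" using qr(2) min dh by metis
    thus ?thesis using qr(1) by simp
  qed
  thus ?thesis using that h1 hx by blast
qed

section \<open>Conjugates of a root of unity\<close>

locale root_of_unity =
  fixes z :: complex and d :: nat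
  assumes prim: "primitive_root_of_unity d z"
begin

lemma d_pos: "d > 0" and z_pow: "z ^ d = 1"
  using prim by (auto simp: primitive_root_of_unity_def)

definition annihilator :: "int poly" where
  "annihilator = Polynomial.monom 1 d - 1"

lemma annihilator: "lead_coeff annihilator = 1" "ipoly annihilator x = x ^ d - 1"
proof -
  have "Polynomial.degree (1 :: int poly) < Polynomial.degree (Polynomial.monom (1::int) d)"
    using d_pos by (simp add: Polynomial.degree_monom_eq)
  hence "lead_coeff annihilator = lead_coeff (Polynomial.monom (1::int) d)"
    unfolding annihilator_def
    by (metis add_uminus_conv_diff degree_minus lead_coeff_add_le add.commute)
  thus "lead_coeff annihilator = 1" by (simp add: Polynomial.degree_monom_eq)
  show "ipoly annihilator x = x ^ d - 1" by (simp add: annihilator_def)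
qed

lemma minimal_polynomial:
  obtains h where "lead_coeff h = 1" "ipoly h z = 0" "\<And>u. ipoly u z = 0 \<Longrightarrow> h dvd u"
  using integral_minimal_polynomial[OF annihilator(1), of z] annihilator(2)[of z] z_pow
  by (metis diff_self)

text \<open>Modulo the monic \<open>h\<close> one may replace \<open>u\<close> by its remainder
  \<open>r\<close>. Then \<open>m - q * r\<close> vanishes at \<open>z\<close> and has smaller
  degree than \<open>h\<close>, so it is zero, and its constant coefficient gives the claim.\<close>

lemma int_dvd_of_ipoly:
  assumes "of_int m = of_int q * ipoly u z"
  shows "q dvd m"
proof -
  obtain h where h: "lead_coeff h = 1" "ipoly h z = 0" "\<And>u. ipoly u z = 0 \<Longrightarrow> h dvd u"
    using minimal_polynomial by blast
  have dh: "Polynomial.degree h > 0"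
  proof (rule ccontr)
    assume "\<not> ?thesis"
    then obtain c where "h = [:c:]" by (metis degree_eq_zeroE neq0_conv)
    thus False using h by simp
  qed
  obtain g r where gr: "u = h * g + r" "r = 0 \<or> Polynomial.degree r < Polynomial.degree h"
    using monic_division[OF h(1)] by blast
  define p where "p = [:m:] - Polynomial.smult q r"
  have "ipoly p z = 0" using assms h(2) by (simp add: p_def gr(1))
  hence "h dvd p" by (rule h(3))
  moreover have "Polynomial.degree p < Polynomial.degree h"
    unfolding p_def using gr(2) dh
    by (intro degree_diff_less) (auto intro: le_less_trans[OF degree_smult_le])
  ultimately have "p = 0" by (metis dvd_imp_degree_le not_le)
  hence "Polynomial.coeff p 0 = 0" by simp
  thus "q dvd m" by (simp add: p_def)
qed

text \<open>If \<open>h\<close> is the minimal polynomial and \<open>x ^ d - 1 = h * g\<close>, then \<open>h(z ^ q)\<close> lies in \<open>q \<int>[z]\<close>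
  by Frobenius. Were it non-zero, then \<open>g(z ^ q) = 0\<close>, and differentiating the factorisation at
  \<open>z ^ q\<close> would give \<open>d \<in> q \<int>[z]\<close>.\<close>

lemma conjugate_root_prime:
  assumes q: "Factorial_Ring.prime q" "\<not> q dvd d" and v: "ipoly v z = 0"
  shows "ipoly v (z ^ q) = 0"
proof -
  obtain h where h: "lead_coeff h = 1" "ipoly h z = 0" "\<And>u. ipoly u z = 0 \<Longrightarrow> h dvd u"
    using minimal_polynomial by blast
  obtain g where g: "annihilator = h * g"
    using h(3)[of annihilator] annihilator(2)[of z] z_pow by auto
  obtain u where u: "\<And>x. ipoly h (x ^ q) = ipoly h x ^ q + of_nat q * ipoly u x"
    using ipoly_frobenius[OF q(1), of h] by blast
  have q0: "q > 0" using q prime_gt_0_nat by blast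
  have hq: "ipoly h (z ^ q) = of_nat q * ipoly u z" using u[of z] h(2) q0 by simp
  have y: "(z ^ q) ^ d = 1" by (metis power_mult mult.commute z_pow power_one)
  have "ipoly h (z ^ q) = 0"
  proof (rule ccontr)
    assume nz: "ipoly h (z ^ q) \<noteq> 0"
    have "ipoly h (z ^ q) * ipoly g (z ^ q) = 0"
      using annihilator(2)[of "z ^ q"] y unfolding g by simp
    hence gq: "ipoly g (z ^ q) = 0" using nz by simp
    have "pderiv annihilator = Polynomial.monom (of_nat d) (d - 1)"
      by (simp add: annihilator_def pderiv_diff pderiv_monom)
    moreover have "pderiv annihilator = h * pderiv g + g * pderiv h"
      unfolding g by (rule pderiv_mult)
    ultimately have "of_nat d * (z ^ q) ^ (d - 1) = ipoly h (z ^ q) * ipoly (pderiv g) (z ^ q)"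
      using gq by (metis ipoly_add ipoly_mult ipoly_monom mult_zero_left add_0_right of_int_of_nat_eq)
    hence "of_nat d * (z ^ q) ^ (d - 1) * z ^ q = of_nat q * ipoly u z * ipoly (pderiv g) (z ^ q) * z ^ q"
      using hq by simp
    moreover have "(z ^ q) ^ (d - 1) * z ^ q = 1" using y d_pos by (metis power_minus_mult)
    ultimately have "of_nat d = of_nat q * ipoly u z * ipoly (pderiv g) (z ^ q) * z ^ q"
      by (metis mult.assoc mult.right_neutral)
    hence "of_int (int d) = of_int (int q) *
      ipoly (u * (pderiv g \<circ>\<^sub>p Polynomial.monom 1 q) * Polynomial.monom 1 q) z"
      by (simp add: mult.assoc)
    hence "int q dvd int d" by (rule int_dvd_of_ipoly)
    thus False using q(2) by simp
  qed
  moreover obtain k where "v = h * k" using h(3)[OF v] by auto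
  ultimately show ?thesis by simp
qed

text \<open>This is the form in which irreducibility of the cyclotomic polynomial is used. Peel off
  a prime \<open>p\<close> of \<open>f\<close>: the relation at \<open>z ^ p\<close> is a relation
  at \<open>z\<close> for the polynomial \<open>v(X^p)\<close>, to which the induction hypothesis
  applies. Hence \<open>v\<close> is generalised.\<close>

lemma conjugate_root:
  assumes "coprime f d" "f > 0" "ipoly v z = 0"
  shows "ipoly v (z ^ f) = 0"
  using assms
proof (induction f arbitrary: v rule: prime_divisors_induct)
  case (factor p f)
  have p: "Factorial_Ring.prime p" and "f > 0" using factor by auto
  have cop: "coprime p d" "coprime f d" using factor.prems by auto
  have "\<not> p dvd d" using cop(1) p by (metis coprime_absorb_left not_prime_unit)
  hence "ipoly v (z ^ p) = 0" using conjugate_root_prime[OF p] factor by blast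
  hence "ipoly (v \<circ>\<^sub>p Polynomial.monom 1 p) z = 0" by simp
  from factor.IH[OF cop(2) \<open>f > 0\<close> this] show ?case by (simp add: mult.commute flip: power_mult)
qed auto

section \<open>Square roots of integers: conjugation and ramification\<close>

text \<open>Conjugating \<open>v ^ 2 = s\<close> leaves two candidates that differ in sign, and
  Frobenius with Euler's criterion selects one modulo \<open>q\<close>. The other sign would place
  \<open>2 * s\<close>, up to sign, in \<open>q \<int>[z]\<close>, whereas \<open>q\<close> is odd
  and does not divide \<open>s\<close>.\<close>

lemma sqrt_conjugate_prime:
  assumes q: "Factorial_Ring.prime q" "\<not> q dvd d" "q \<noteq> 2"
    and v: "(ipoly v z)\<^sup>2 = of_int s" and s: "s dvd int d"
  shows "ipoly v (z ^ q) = of_int (Legendre s q) * ipoly v z"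
proof -
  have q2: "q > 2" using q prime_ge_2_nat[of q] by auto
  have nqs: "\<not> int q dvd s" using s q(2) by (metis dvd_trans int_dvd_int_iff)
  obtain u where u: "\<And>x. ipoly v (x ^ q) = ipoly v x ^ q + of_nat q * ipoly u x"
    using ipoly_frobenius[OF q(1), of v] by blast
  obtain m where m: "q = 2 * m + 1" using q q2 prime_odd_nat by (metis oddE)
  have "[Legendre s q = s ^ m] (mod int q)" using euler_criterion[of q s] q(1) q2 m by simp
  then obtain t where t: "s ^ m = Legendre s q + int q * t"
    by (metis cong_iff_lin cong_sym)
  have "ipoly v z ^ q = of_int (s ^ m) * ipoly v z"
    unfolding m by (simp add: power_add power_mult v)
  hence 1: "ipoly v (z ^ q) = of_int (Legendre s q) * ipoly v z + of_nat q * (of_int t * ipoly v z + ipoly u z)"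
    using u[of z] unfolding t by (simp add: algebra_simps)
  have L: "Legendre s q = 1 \<or> Legendre s q = -1"
    using nqs by (auto simp: Legendre_def cong_0_iff)
  have "ipoly (v ^ 2 - [:s:]) z = 0" using v by simp
  hence "ipoly (v ^ 2 - [:s:]) (z ^ q) = 0" by (rule conjugate_root_prime[OF q(1,2)])
  hence "(ipoly v (z ^ q))\<^sup>2 = (ipoly v z)\<^sup>2" using v by simp
  hence pm: "ipoly v (z ^ q) = ipoly v z \<or> ipoly v (z ^ q) = - ipoly v z"
    by (simp add: power2_eq_iff)
  show ?thesis
  proof (rule ccontr)
    assume "\<not> ?thesis"
    hence "ipoly v (z ^ q) = - of_int (Legendre s q) * ipoly v z" using pm L by auto
    with 1 have "- of_int (Legendre s q) * ipoly v z =
      of_int (Legendre s q) * ipoly v z + of_nat q * (of_int t * ipoly v z + ipoly u z)" by metis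
    moreover have "b = - 2 * a" if "- a = a + b" for a b :: complex
    proof -
      have "b = - a - a" unfolding that by simp
      thus ?thesis by simp
    qed
    ultimately have "- 2 * of_int (Legendre s q) * ipoly v z = of_nat q * (of_int t * ipoly v z + ipoly u z)"
      by (metis mult.assoc mult_minus_left)
    \<comment> \<open>One more factor \<open>ipoly v z\<close> turns the left-hand side into an
      integer, so that \<open>int_dvd_of_ipoly\<close> applies.\<close>
    hence "(- 2 * of_int (Legendre s q) * ipoly v z) * ipoly v z =
      of_nat q * (of_int t * ipoly v z + ipoly u z) * ipoly v z" by simp
    hence "of_int (- 2 * Legendre s q * s) = of_int (int q) * ipoly ((Polynomial.smult t v + u) * v) z"
      using v by (simp add: power2_eq_square mult.assoc)
    hence "int q dvd - 2 * Legendre s q * s" by (rule int_dvd_of_ipoly)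
    hence "int q dvd 2 * s" using L by auto
    hence "int q dvd 2 \<or> int q dvd s" using q(1) by (simp add: prime_dvd_mult_iff)
    thus False using nqs q2 by (auto dest: zdvd_imp_le)
  qed
qed

lemma Jacobi_prime_mult:
  assumes "Factorial_Ring.prime p" "f > 0"
  shows "Jacobi s (int (p * f)) = Legendre s (int p) * Jacobi s (int f)"
  using assms by (simp add: Jacobi_def prime_factorization_mult prime_factorization_prime)

text \<open>The prime case is itself an integer relation at \<open>z\<close>; conjugating it by the
  remaining factor of \<open>f\<close> makes the Legendre symbols multiply. Evenness of
  \<open>d\<close> keeps 2 from dividing \<open>f\<close>.\<close>

lemma sqrt_conjugate:
  assumes "coprime f d" "f > 0" "even d"
    and v: "(ipoly v z)\<^sup>2 = of_int s" and s: "s dvd int d"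
  shows "ipoly v (z ^ f) = of_int (Jacobi s (int f)) * ipoly v z"
  using assms(1,2)
proof (induction f rule: prime_divisors_induct)
  case (unit f)
  thus ?case by (simp add: Jacobi_def)
next
  case (factor p f)
  have p: "Factorial_Ring.prime p" and f: "f > 0" using factor by auto
  have cop: "coprime p d" "coprime f d" using factor.prems by auto
  have npd: "\<not> p dvd d" using cop(1) p by (metis coprime_absorb_left not_prime_unit)
  hence "p \<noteq> 2" using \<open>even d\<close> by auto
  have "ipoly (v \<circ>\<^sub>p Polynomial.monom 1 p - Polynomial.smult (Legendre s p) v) z = 0"
    using sqrt_conjugate_prime[OF p npd \<open>p \<noteq> 2\<close> v s] by simp
  from conjugate_root[OF cop(2) f this]
  have "ipoly v (z ^ (p * f)) = of_int (Legendre s p) * ipoly v (z ^ f)"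
    by (simp add: mult.commute flip: power_mult)
  thus ?case using factor.IH[OF cop(2) f] Jacobi_prime_mult[OF p f, of s] by simp
qed auto

text \<open>For \<open>n = totient d\<close>, iterated Frobenius gives \<open>x ^ (q ^ n) \<equiv> x\<close> modulo \<open>q \<int>[z]\<close>, and
  the left-hand side is a multiple of \<open>x\<^sup>2\<close>.\<close>

lemma ipoly_dvd_of_square:
  assumes q: "Factorial_Ring.prime q" "\<not> q dvd d"
    and sq: "(ipoly u z)\<^sup>2 = of_nat q * ipoly t z"
  obtains t' where "ipoly u z = of_nat q * ipoly t' z"
proof -
  have "coprime q d" using q by (simp add: prime_imp_coprime)
  hence "[q ^ totient d = 1] (mod d)" by (rule euler_theorem)
  define n where "n = totient d"
  have "n > 0" using d_pos by (simp add: n_def)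
  have "z ^ (q ^ n) = z"
  proof -
    have "q ^ n \<ge> 1" using prime_gt_0_nat[OF q(1)] by simp
    moreover have "d dvd q ^ n - 1"
      using \<open>[q ^ totient d = 1] (mod d)\<close> unfolding n_def by (rule cong_to_1_nat)
    ultimately obtain k where "q ^ n = Suc (d * k)" by (metis Suc_pred' dvdE One_nat_def less_eq_Suc_le Suc_diff_1)
    thus ?thesis by (simp add: power_mult z_pow)
  qed
  obtain w where w: "\<And>x. ipoly u (x ^ (q ^ n)) = ipoly u x ^ (q ^ n) + of_nat q * ipoly w x"
    using ipoly_frobenius_power[OF q(1), of u n] by blast
  have "q ^ n \<ge> q ^ 1" using \<open>n > 0\<close> prime_gt_0_nat[OF q(1)] by (intro power_increasing) auto
  hence "q ^ n \<ge> 2" using prime_ge_2_nat[OF q(1)] by simp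
  then obtain k where k: "q ^ n = 2 + k" using le_Suc_ex by blast
  have "ipoly u z = (ipoly u z)\<^sup>2 * ipoly u z ^ k + of_nat q * ipoly w z"
    using w[of z] unfolding \<open>z ^ (q ^ n) = z\<close> unfolding k power_add .
  hence "ipoly u z = of_nat q * ipoly (t * u ^ k + w) z"
    unfolding sq by (simp add: algebra_simps)
  thus ?thesis using that by blast
qed

text \<open>The factor \<open>c\<close> admits square roots in \<open>\<rat>(z)\<close>, whose
  elements have denominators. Descent on \<open>c\<close>: let the prime \<open>q\<close> divide
  \<open>s\<close> but not \<open>d\<close>. Then \<open>q\<close> divides the square of
  \<open>ipoly u z\<close> and hence \<open>ipoly u z\<close>, so \<open>q ^ 2\<close> divides
  \<open>c ^ 2 * s\<close>. As \<open>s\<close> is squarefree, \<open>q\<close> divides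
  \<open>c\<close> and can be cancelled.\<close>

lemma sqrt_conductor:
  assumes "(ipoly u z)\<^sup>2 = of_int (int c ^ 2 * s)" "c > 0" "squarefree s"
  shows "s dvd int d"
proof (rule ccontr)
  assume "\<not> s dvd int d"
  moreover have "s \<noteq> 0" using \<open>squarefree s\<close> by auto
  ultimately obtain q' where q': "Factorial_Ring.prime q'" "multiplicity q' s > multiplicity q' (int d)"
    using multiplicity_le_imp_dvd[of s "int d"] by (meson not_le)
  have "multiplicity q' s \<le> 1"
    using \<open>squarefree s\<close> \<open>s \<noteq> 0\<close> q'(1) squarefree_factorial_semiring'' by blast
  hence "multiplicity q' (int d) = 0" "multiplicity q' s = 1" using q'(2) by linarith+
  hence q's: "q' dvd s" "\<not> q' dvd int d" using q'(1) d_pos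
    by (metis not_dvd_imp_multiplicity_0 zero_neq_one, metis multiplicity_eq_zero_iff of_nat_eq_0_iff not_prime_unit less_irrefl)
  define q where "q = nat q'"
  have qi: "int q = q'" using q'(1) prime_ge_0_int by (simp add: q_def)
  have q: "Factorial_Ring.prime q" "\<not> q dvd d" "int q dvd s"
    using q'(1) q's qi by auto
  show False using assms(1,2)
  proof (induction c arbitrary: u rule: less_induct)
    case (less c)
    obtain s' where s': "s = int q * s'" using q(3) by auto
    have "(ipoly u z)\<^sup>2 = of_nat q * ipoly [:int c ^ 2 * s':] z"
      using less.prems s' by simp
    from ipoly_dvd_of_square[OF q(1,2) this] obtain t where t: "ipoly u z = of_nat q * ipoly t z" .
    have "of_int (int c ^ 2 * s) = of_int (int q ^ 2) * ipoly (t ^ 2) z"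
      using less.prems unfolding t by (simp add: power_mult_distrib)
    hence "int q ^ 2 dvd int c ^ 2 * s" by (rule int_dvd_of_ipoly)
    hence "int q * int q dvd int q * (int c ^ 2 * s')" by (simp add: s' power2_eq_square algebra_simps)
    hence "int q dvd int c ^ 2 * s'" using q(1) by auto
    moreover have "\<not> int q dvd s'"
    proof
      assume "int q dvd s'"
      hence "int q ^ 2 dvd s" unfolding s' by (simp add: power2_eq_square)
      thus False using \<open>squarefree s\<close> q(1) by (auto simp: squarefree_def)
    qed
    ultimately have "int q dvd int c ^ 2" using q(1) by (metis prime_dvd_mult_iff prime_int_nat_transfer prime_nat_int_transfer)
    hence "q dvd c" using q(1) by (metis prime_dvd_power int_dvd_int_iff prime_nat_int_transfer)
    then obtain c' where c': "c = q * c'" by blast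
    have "c' > 0" using c' less.prems by auto
    moreover have "c' < c" using c' \<open>c' > 0\<close> prime_gt_1_nat[OF q(1)] by simp
    moreover have "(ipoly t z)\<^sup>2 = of_int (int c' ^ 2 * s)"
      using less.prems t c' prime_gt_0_nat[OF q(1)] by (simp add: power_mult_distrib)
    ultimately show False using less.IH by blast
  qed
qed

end

section \<open>Roots of unity and the factorisation of \<open>X^n - 1\<close>\<close>

lemma root_of_unity_powers_inj:
  assumes "primitive_root_of_unity n w"
  shows "inj_on (\<lambda>j. w ^ j) {..<n}"
proof (rule linorder_inj_onI)
  have n: "w ^ n = 1" "\<And>m. 0 < m \<Longrightarrow> m < n \<Longrightarrow> w ^ m \<noteq> 1"
    using assms by (auto simp: primitive_root_of_unity_def)
  have w0: "w \<noteq> 0" using assms by (auto simp: primitive_root_of_unity_def power_0_left)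
  fix i j assume ij: "i < j" "i \<in> {..<n}" "j \<in> {..<n}"
  show "w ^ i \<noteq> w ^ j"
  proof
    assume "w ^ i = w ^ j"
    also have "w ^ j = w ^ i * w ^ (j - i)" using ij by (simp flip: power_add)
    finally have "w ^ (j - i) = 1" using w0 by simp
    moreover have "0 < j - i" "j - i < n" using ij by auto
    ultimately show False using n(2) by blast
  qed
qed auto

text \<open>Both sides are monic of degree \<open>n\<close>, so their difference has degree below
  \<open>n\<close>; it vanishes at the \<open>n\<close> distinct powers of \<open>w\<close>.\<close>

lemma unity_polynomial_factorization:
  assumes w: "primitive_root_of_unity n w"
  shows "Polynomial.monom 1 n - 1 = (\<Prod>j\<in>{..<n}. [:- (w ^ j), 1:])"
proof -
  have n: "n > 0" "w ^ n = 1"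
    using w by (auto simp: primitive_root_of_unity_def)
  define P where "P = (\<Prod>j\<in>{..<n}. [:- (w ^ j), 1:])"
  define Q where "Q = Polynomial.monom 1 n - (1 :: complex poly)"
  have degQ: "Polynomial.degree (Q - P) < n"
  proof -
    have degP: "Polynomial.degree P = n" unfolding P_def
      by (subst degree_prod_eq_sum_degree) auto
    have "lead_coeff P = 1" unfolding P_def by (simp add: lead_coeff_prod)
    hence "Polynomial.coeff (Q - P) n = 0"
      using n(1) unfolding degP by (simp add: Q_def)
    moreover have "Polynomial.degree (Q - P) \<le> n" unfolding Q_def
      by (intro degree_diff_le) (auto simp: degP Polynomial.degree_monom_eq)
    ultimately show ?thesis using n(1)
      by (metis degree_0 eq_zero_or_degree_less)
  qed
  have "poly (Q - P) x = 0" if x: "x \<in> (\<lambda>j. w ^ j) ` {..<n}" for x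
  proof -
    obtain j where j: "j < n" "x = w ^ j" using x by auto
    have "x ^ n = 1" unfolding j by (metis n(2) power_mult mult.commute power_one)
    moreover have "poly P x = 0" using j unfolding P_def by (auto simp: poly_prod)
    ultimately show ?thesis by (simp add: Q_def poly_monom)
  qed
  hence sub: "(\<lambda>j. w ^ j) ` {..<n} \<subseteq> {x. poly (Q - P) x = 0}" by blast
  have "Q = P"
  proof (rule ccontr)
    assume "Q \<noteq> P"
    hence nz: "Q - P \<noteq> 0" by simp
    hence "card ((\<lambda>j. w ^ j) ` {..<n}) \<le> Polynomial.degree (Q - P)"
      using card_mono[OF poly_roots_finite[OF nz] sub] card_poly_roots_bound[OF nz] by linarith
    thus False using degQ card_image[OF root_of_unity_powers_inj[OF w]] by simp
  qed
  thus ?thesis by (simp add: P_def Q_def)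
qed

lemma root_of_unity_is_power:
  assumes w: "primitive_root_of_unity n w" and "y ^ n = 1"
  obtains j where "j < n" "y = w ^ j"
proof -
  have "poly (Polynomial.monom 1 n - 1) y = 0" using assms by (simp add: poly_monom)
  thus ?thesis
    unfolding unity_polynomial_factorization[OF w] using that by (auto simp: poly_prod)
qed

text \<open>Cancel \<open>X - 1\<close> in the factorisation of \<open>X^n - 1\<close> and evaluate
  the quotient \<open>1 + X + ... + X^(n-1)\<close> at 1.\<close>

lemma prod_one_minus_root_of_unity:
  assumes w: "primitive_root_of_unity n w"
  shows "(\<Prod>j\<in>{1..<n}. 1 - w ^ j) = of_nat n"
proof -
  have n: "n > 0" using w by (auto simp: primitive_root_of_unity_def)
  have "[:-1, 1:] * (\<Prod>j\<in>{1..<n}. [:- (w ^ j), 1:]) = (\<Prod>j\<in>{..<n}. [:- (w ^ j), 1:])"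
    using n by (simp add: lessThan_atLeast0 prod.atLeast_Suc_lessThan)
  also have "\<dots> = [:-1, 1:] * (\<Sum>i<n. [:0, 1:] ^ i)"
    using power_diff_1_eq[of "[:0, 1 :: complex:]" n]
    by (simp add: monom_altdef one_pCons flip: unity_polynomial_factorization[OF w])
  finally have "(\<Prod>j\<in>{1..<n}. [:- (w ^ j), 1:]) = (\<Sum>i<n. [:0, 1:] ^ i)"
    by (subst (asm) mult_cancel_left) simp
  from arg_cong[OF this, of "\<lambda>p. poly p 1"] show ?thesis
    by (simp add: poly_prod poly_sum)
qed

lemma primitive_root_of_unity_power:
  assumes z: "primitive_root_of_unity (m * n) z" and m: "m > 0"
  shows "primitive_root_of_unity n (z ^ m)"
  using assms unfolding primitive_root_of_unity_def
  by (auto simp flip: power_mult)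

section \<open>Explicit square roots in \<open>\<int>[z]\<close>\<close>

context root_of_unity
begin

text \<open>The ring \<open>\<int>[z]\<close>.\<close>

abbreviation int_span :: "complex set" where
  "int_span \<equiv> range (\<lambda>u. ipoly u z)"

lemma z_power_in_int_span: "z ^ n \<in> int_span"
  by (rule image_eqI[of _ _ "Polynomial.monom 1 n"]) auto

lemma int_span_mult:
  assumes "x \<in> int_span" "y \<in> int_span"
  shows "x * y \<in> int_span"
proof -
  obtain u v where "x = ipoly u z" "y = ipoly v z" using assms by blast
  hence "x * y = ipoly (u * v) z" by simp
  thus ?thesis by blast
qed

lemma int_span_prod: "(\<And>i. i \<in> I \<Longrightarrow> f i \<in> int_span) \<Longrightarrow> (\<Prod>i\<in>I. f i) \<in> int_span"
proof (induction I rule: infinite_finite_induct)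
  case (insert i I)
  have "f i * (\<Prod>i\<in>I. f i) \<in> int_span"
    by (rule int_span_mult) (use insert in blast)+
  thus ?case using insert.hyps by simp
qed (auto intro: image_eqI[of _ _ 1])

lemma one_minus_z_power_in_int_span: "1 - z ^ n \<in> int_span"
  by (rule image_eqI[of _ _ "1 - Polynomial.monom 1 n"]) auto

lemma imaginary_unit_in_int_span:
  assumes "4 dvd d"
  obtains i where "i \<in> int_span" "i ^ 2 = -1"
proof -
  obtain m where m: "d = m * 4" using assms by (metis dvdE mult.commute)
  have "primitive_root_of_unity 4 (z ^ m)"
    using primitive_root_of_unity_power[of m 4 z] prim m d_pos by simp
  hence 4: "(z ^ m) ^ 4 = 1" "(z ^ m) ^ 2 \<noteq> 1" by (auto simp: primitive_root_of_unity_def)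
  have "((z ^ m)\<^sup>2 - 1) * ((z ^ m)\<^sup>2 + 1) = (z ^ m) ^ 4 - 1"
    by (simp add: algebra_simps flip: power_add)
  hence "(z ^ m)\<^sup>2 = -1" using 4 by (simp add: eq_neg_iff_add_eq_0)
  thus ?thesis using that z_power_in_int_span by blast
qed

text \<open>Pairing the factors \<open>1 - w ^ j\<close> and \<open>1 - w ^ (p - j)\<close> in
  \<open>p = \<Prod>\<^sub>j (1 - w ^ j)\<close>, each pair is \<open>- w ^ (p - j)\<close> times a square; \<open>- 1\<close> is a square since
  \<open>4\<close> divides \<open>d\<close>, and \<open>w\<close> is one since its order is odd.\<close>

lemma sqrt_prime_in_int_span:
  assumes p: "Factorial_Ring.prime p" "p dvd d" and "8 dvd d"
  obtains x where "x \<in> int_span" "x ^ 2 = of_nat p"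
proof -
  have "4 dvd d" using \<open>8 dvd d\<close> by (rule dvd_trans[rotated]) simp
  then obtain i where i: "i \<in> int_span" "i ^ 2 = -1" using imaginary_unit_in_int_span by blast
  show ?thesis
  proof (cases "p = 2")
    case True
    obtain m where m: "d = m * 8" using \<open>8 dvd d\<close> by (metis dvdE mult.commute)
    have "primitive_root_of_unity 8 (z ^ m)"
      using primitive_root_of_unity_power[of m 8 z] prim m d_pos by simp
    hence 8: "(z ^ m) ^ 8 = 1" "(z ^ m) ^ 4 \<noteq> 1" by (auto simp: primitive_root_of_unity_def)
    define e where "e = z ^ m"
    have "(e ^ 4 - 1) * (e ^ 4 + 1) = e ^ 8 - 1"
      by (simp add: algebra_simps flip: power_add)
    hence e: "e ^ 4 = -1" using 8 by (simp add: e_def eq_neg_iff_add_eq_0)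
    \<comment> \<open>Because \<open>e ^ 4 = -1\<close>, the number \<open>e * (1 - e ^ 2)\<close>
      equals \<open>e + inverse e\<close>, the familiar expression for a square root of 2 by eighth
      roots of unity.\<close>
    have "(e * (1 - e ^ 2)) ^ 2 = e ^ 2 * (1 + e ^ 4) - 2 * e ^ 4"
      by (simp add: power2_eq_square power4_eq_xxxx algebra_simps)
    hence "(e * (1 - e ^ 2)) ^ 2 = of_nat p" using e True by simp
    moreover have "e * (1 - e ^ 2) \<in> int_span" unfolding e_def power_mult[symmetric]
      by (intro int_span_mult z_power_in_int_span one_minus_z_power_in_int_span)
    ultimately show ?thesis using that by blast
  next
    case False
    obtain m where m: "d = m * p" using p(2) by (metis dvdE mult.commute)
    define w where "w = z ^ m"
    have w: "primitive_root_of_unity p w" unfolding w_def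
      using primitive_root_of_unity_power[of m p z] prim m d_pos by simp
    have wp: "w ^ p = 1" using w by (auto simp: primitive_root_of_unity_def)
    obtain h where h: "p = 2 * h + 1"
      using p False by (metis oddE prime_odd_nat prime_ge_2_nat le_neq_implies_less)
    have sqw: "(w ^ (h + 1)) ^ 2 = w"
    proof -
      have "(w ^ (h + 1)) ^ 2 = w ^ p * w"
        unfolding h power_mult[symmetric] power_Suc2[symmetric] by (simp add: algebra_simps)
      thus ?thesis using wp by simp
    qed
    have pair: "(i * (w ^ (h + 1)) ^ (p - j) * (1 - w ^ j)) ^ 2 = (1 - w ^ j) * (1 - w ^ (p - j))"
      if "j \<in> {1..h}" for j
    proof -
      have jp: "w ^ (p - j) * w ^ j = 1" using that wp h by (simp flip: power_add)
      have c: "((w ^ (h + 1)) ^ (p - j)) ^ 2 = ((w ^ (h + 1)) ^ 2) ^ (p - j)"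
        by (simp only: power_mult[symmetric] mult_ac)
      have "(i * (w ^ (h + 1)) ^ (p - j) * (1 - w ^ j)) ^ 2 =
        i ^ 2 * ((w ^ (h + 1)) ^ 2) ^ (p - j) * (1 - w ^ j) ^ 2"
        by (simp only: power_mult_distrib c)
      also have "\<dots> = - (w ^ (p - j) * (1 - w ^ j)) * (1 - w ^ j)"
        unfolding sqw i(2) by (simp add: power2_eq_square)
      also have "w ^ (p - j) * (1 - w ^ j) = w ^ (p - j) - 1"
        using jp by (simp add: algebra_simps)
      finally show ?thesis by (simp add: algebra_simps)
    qed
    define x where "x = (\<Prod>j\<in>{1..h}. i * (w ^ (h + 1)) ^ (p - j) * (1 - w ^ j))"
    have "x \<in> int_span" unfolding x_def w_def power_mult[symmetric]
      by (intro int_span_prod int_span_mult i(1) z_power_in_int_span one_minus_z_power_in_int_span)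
    moreover have "x ^ 2 = of_nat p"
    proof -
      have "x ^ 2 = (\<Prod>j\<in>{1..h}. (1 - w ^ j) * (1 - w ^ (p - j)))"
        unfolding x_def prod_power_distrib by (rule prod.cong) (auto simp only: pair)
      also have "\<dots> = (\<Prod>j\<in>{1..h}. 1 - w ^ j) * (\<Prod>j\<in>{1..h}. 1 - w ^ (p - j))"
        by (rule prod.distrib)
      also have "(\<Prod>j\<in>{1..h}. 1 - w ^ (p - j)) = (\<Prod>j\<in>{h+1..<p}. 1 - w ^ j)"
        by (rule prod.reindex_bij_witness[of _ "\<lambda>j. p - j" "\<lambda>j. p - j"]) (auto simp: h)
      also have "(\<Prod>j\<in>{1..h}. 1 - w ^ j) * \<dots> = (\<Prod>j\<in>{1..h} \<union> {h+1..<p}. 1 - w ^ j)"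
        by (rule prod.union_disjoint[symmetric]) auto
      also have "{1..h} \<union> {h+1..<p} = {1..<p}" by (auto simp: h)
      finally show ?thesis using prod_one_minus_root_of_unity[OF w] by simp
    qed
    ultimately show ?thesis using that by blast
  qed
qed

text \<open>Square roots of the prime factors multiply to one of the absolute value of
  \<open>s\<close>; a negative sign costs one further factor, a square root of -1.\<close>

lemma sqrt_in_int_span:
  assumes "8 dvd d" "s dvd int d" "squarefree s"
  obtains x where "x \<in> int_span" "x ^ 2 = of_int s"
proof -
  have "4 dvd d" using \<open>8 dvd d\<close> by (rule dvd_trans[rotated]) simp
  then obtain i where i: "i \<in> int_span" "i ^ 2 = -1" using imaginary_unit_in_int_span by blast
  have nat: "\<exists>x\<in>int_span. x ^ 2 = of_nat n" if "n dvd d" "n > 0" for n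
    using that
  proof (induction n rule: prime_divisors_induct)
    case (unit n)
    moreover have "ipoly 1 z \<in> int_span" by (rule rangeI)
    ultimately show ?case by (intro bexI[of _ "ipoly 1 z"]) auto
  next
    case (factor p n)
    have "n dvd d" "p dvd d" using factor.prems by (auto dest: dvd_mult_left dvd_mult_right)
    then obtain x where x: "x \<in> int_span" "x ^ 2 = of_nat n"
      using factor by auto
    obtain y where y: "y \<in> int_span" "y ^ 2 = of_nat p"
      using sqrt_prime_in_int_span[OF factor(1) \<open>p dvd d\<close> assms(1)] by blast
    show ?case using x y int_span_mult[of y x]
      by (intro bexI[of _ "y * x"]) (auto simp: power_mult_distrib)
  qed auto
  have "nat \<bar>s\<bar> dvd d" using assms(2) by (simp add: nat_abs_dvd_iff)
  moreover have "s \<noteq> 0" using assms(3) by auto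
  ultimately obtain x where x: "x \<in> int_span" "x ^ 2 = of_nat (nat \<bar>s\<bar>)" using nat[of "nat \<bar>s\<bar>"] by auto
  show ?thesis
  proof (cases "s > 0")
    case True
    thus ?thesis using x that by auto
  next
    case False
    hence "(i * x) ^ 2 = of_int s" using x i by (simp add: power_mult_distrib)
    thus ?thesis using that x i int_span_mult by blast
  qed
qed

end

section \<open>Subfields of the complex numbers and their embeddings\<close>

text \<open>Closure under \<open>inverse\<close> can be required at 0 as well, since
  \<open>inverse 0 = 0\<close>.\<close>

definition complex_subfield :: "complex set \<Rightarrow> bool" where
  "complex_subfield K \<longleftrightarrow> 1 \<in> K \<and> (\<forall>x\<in>K. - x \<in> K \<and> inverse x \<in> K) \<and>
     (\<forall>x\<in>K. \<forall>y\<in>K. x + y \<in> K \<and> x * y \<in> K)"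

lemma complex_subfieldD:
  assumes "complex_subfield K"
  shows "1 \<in> K" "0 \<in> K" "x \<in> K \<Longrightarrow> - x \<in> K" "x \<in> K \<Longrightarrow> inverse x \<in> K"
    "x \<in> K \<Longrightarrow> y \<in> K \<Longrightarrow> x + y \<in> K" "x \<in> K \<Longrightarrow> y \<in> K \<Longrightarrow> x * y \<in> K"
    "x \<in> K \<Longrightarrow> y \<in> K \<Longrightarrow> x - y \<in> K" "x \<in> K \<Longrightarrow> y \<in> K \<Longrightarrow> x / y \<in> K"
    "x \<in> K \<Longrightarrow> x ^ n \<in> K" "of_nat n \<in> K" "of_int m \<in> K"
proof -
  show 1: "1 \<in> K" using assms unfolding complex_subfield_def by blast
  show neg: "- x \<in> K" if "x \<in> K" for x using that assms unfolding complex_subfield_def by blast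
  show inv: "inverse x \<in> K" if "x \<in> K" for x using that assms unfolding complex_subfield_def by blast
  show add: "x + y \<in> K" if "x \<in> K" "y \<in> K" for x y using that assms unfolding complex_subfield_def by blast
  show mult: "x * y \<in> K" if "x \<in> K" "y \<in> K" for x y using that assms unfolding complex_subfield_def by blast
  show 0: "0 \<in> K" using add[OF 1 neg[OF 1]] by simp
  show "x - y \<in> K" if "x \<in> K" "y \<in> K" for x y using add[OF that(1) neg[OF that(2)]] by simp
  show div: "x / y \<in> K" if "x \<in> K" "y \<in> K" for x y
    using mult[OF that(1) inv[OF that(2)]] by (simp add: field_simps)
  show "x ^ n \<in> K" if "x \<in> K" for x n using that by (induction n) (auto intro: 1 mult)
  show nat: "of_nat n \<in> K" for n by (induction n) (auto intro: 0 1 add)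
  show int: "of_int m \<in> K" for m
    by (cases m rule: int_cases2) (auto intro: nat neg)
qed

lemma complex_subfield_Rats:
  assumes "complex_subfield K"
  shows "\<rat> \<subseteq> K"
proof
  fix q :: complex assume "q \<in> \<rat>"
  then obtain a b where "q = of_int a / of_int b" by (rule Rats_cases') blast
  thus "q \<in> K" using complex_subfieldD(8,11)[OF assms] by simp
qed

lemma complex_subfield_prod:
  assumes "complex_subfield K" "\<And>i. i \<in> I \<Longrightarrow> f i \<in> K"
  shows "(\<Prod>i\<in>I. f i) \<in> K"
  using assms(2)
  by (induction I rule: infinite_finite_induct) (auto intro: complex_subfieldD[OF assms(1)])

text \<open>Values outside \<open>K\<close> are left free, and the image may leave \<open>K\<close>.
  The clause for 1 excludes the zero map; compatibility with inverses and the identity on \<rat>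
  follow.\<close>

definition field_embedding :: "complex set \<Rightarrow> (complex \<Rightarrow> complex) \<Rightarrow> bool" where
  "field_embedding K \<sigma> \<longleftrightarrow> \<sigma> 1 = 1 \<and> (\<forall>x\<in>K. \<forall>y\<in>K. \<sigma> (x + y) = \<sigma> x + \<sigma> y \<and> \<sigma> (x * y) = \<sigma> x * \<sigma> y)"

lemma field_embeddingD:
  assumes K: "complex_subfield K" and h: "field_embedding K \<sigma>"
  shows "\<sigma> 1 = 1" "\<sigma> 0 = 0" "x \<in> K \<Longrightarrow> y \<in> K \<Longrightarrow> \<sigma> (x + y) = \<sigma> x + \<sigma> y"
    "x \<in> K \<Longrightarrow> y \<in> K \<Longrightarrow> \<sigma> (x * y) = \<sigma> x * \<sigma> y"
    "x \<in> K \<Longrightarrow> \<sigma> (- x) = - \<sigma> x" "x \<in> K \<Longrightarrow> \<sigma> (inverse x) = inverse (\<sigma> x)"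
    "x \<in> K \<Longrightarrow> y \<in> K \<Longrightarrow> \<sigma> (x / y) = \<sigma> x / \<sigma> y"
    "x \<in> K \<Longrightarrow> \<sigma> (x ^ n) = \<sigma> x ^ n" "\<sigma> (of_nat n) = of_nat n" "\<sigma> (of_int m) = of_int m"
    "q \<in> \<rat> \<Longrightarrow> \<sigma> q = q"
proof -
  note K = complex_subfieldD[OF K]
  show 1: "\<sigma> 1 = 1" using h unfolding field_embedding_def by blast
  show add: "\<sigma> (x + y) = \<sigma> x + \<sigma> y" if "x \<in> K" "y \<in> K" for x y
    using that h unfolding field_embedding_def by blast
  show mult: "\<sigma> (x * y) = \<sigma> x * \<sigma> y" if "x \<in> K" "y \<in> K" for x y
    using that h unfolding field_embedding_def by blast
  show 0: "\<sigma> 0 = 0" using add[OF K(2) K(2)] by simp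
  show neg: "\<sigma> (- x) = - \<sigma> x" if "x \<in> K" for x
    using add[OF that K(3)[OF that]] 0 by (simp add: eq_neg_iff_add_eq_0 add.commute)
  show inv: "\<sigma> (inverse x) = inverse (\<sigma> x)" if "x \<in> K" for x
  proof (cases "x = 0")
    case False
    hence "\<sigma> x * \<sigma> (inverse x) = 1" using mult[OF that K(4)[OF that]] 1 by simp
    thus ?thesis by (metis inverse_unique)
  qed (simp add: 0)
  show div: "\<sigma> (x / y) = \<sigma> x / \<sigma> y" if "x \<in> K" "y \<in> K" for x y
    using mult[OF that(1) K(4)[OF that(2)]] inv[OF that(2)] by (simp add: divide_inverse)
  show "\<sigma> (x ^ n) = \<sigma> x ^ n" if "x \<in> K" for x n
    using that by (induction n) (auto simp: 1 mult K)
  show nat: "\<sigma> (of_nat n) = of_nat n" for n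
    by (induction n) (auto simp: 0 1 add K)
  show int: "\<sigma> (of_int m) = of_int m" for m
    by (cases m rule: int_cases2) (auto simp: nat neg K)
  show "\<sigma> q = q" if q: "q \<in> \<rat>" for q
  proof -
    obtain a b where "q = of_int a / of_int b" using q by (rule Rats_cases') blast
    thus ?thesis by (simp add: div int K)
  qed
qed

lemma field_embedding_inj:
  assumes K: "complex_subfield K" and h: "field_embedding K \<sigma>"
  shows "inj_on \<sigma> K"
proof (rule inj_onI)
  fix x y assume xy: "x \<in> K" "y \<in> K" "\<sigma> x = \<sigma> y"
  note K' = complex_subfieldD[OF K] and h' = field_embeddingD[OF K h]
  have *: "\<sigma> (x - y) = 0"
    using h'(3)[OF xy(1) K'(3)[OF xy(2)]] h'(5)[OF xy(2)] xy(3) by simp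
  show "x = y"
  proof (rule ccontr)
    assume "x \<noteq> y"
    hence "\<sigma> ((x - y) * inverse (x - y)) = 1" using h'(1) by simp
    thus False using * h'(4)[OF K'(7)[OF xy(1,2)] K'(4)[OF K'(7)[OF xy(1,2)]]] by simp
  qed
qed

lemma field_embedding_prod:
  assumes K: "complex_subfield K" and h: "field_embedding K \<sigma>" and "\<And>i. i \<in> I \<Longrightarrow> f i \<in> K"
  shows "\<sigma> (\<Prod>i\<in>I. f i) = (\<Prod>i\<in>I. \<sigma> (f i))"
  using assms(3)
  by (induction I rule: infinite_finite_induct)
     (auto simp: field_embeddingD[OF K h] complex_subfield_prod[OF K])

section \<open>Adjoining one square root\<close>

text \<open>For \<open>r ^ 2 \<in> K\<close> this is \<open>K(r)\<close>, including the degenerate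
  case \<open>r \<in> K\<close>, so that roots can be adjoined one by one without knowing whether
  they are new.\<close>

definition quad_ext :: "complex set \<Rightarrow> complex \<Rightarrow> complex set" where
  "quad_ext K r = {x + y * r |x y. x \<in> K \<and> y \<in> K}"

lemma quad_ext_trivial:
  assumes K: "complex_subfield K" and "r \<in> K"
  shows "quad_ext K r = K"
proof
  show "quad_ext K r \<subseteq> K" using assms unfolding quad_ext_def by (auto intro: complex_subfieldD)
  show "K \<subseteq> quad_ext K r"
  proof
    fix x assume "x \<in> K"
    thus "x \<in> quad_ext K r" unfolding quad_ext_def
      using complex_subfieldD(2)[OF K] by (intro CollectI exI[of _ x] exI[of _ 0]) auto
  qed
qed

lemma quad_extI: "x \<in> K \<Longrightarrow> y \<in> K \<Longrightarrow> x + y * r \<in> quad_ext K r"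
  unfolding quad_ext_def by blast

lemma quad_ext_superset:
  assumes K: "complex_subfield K"
  shows "K \<subseteq> quad_ext K r" "r \<in> quad_ext K r"
proof -
  show "K \<subseteq> quad_ext K r" using quad_extI[of _ K 0 r] complex_subfieldD(2)[OF K] by auto
  show "r \<in> quad_ext K r" using quad_extI[of 0 K 1 r] complex_subfieldD(1,2)[OF K] by auto
qed

lemma quad_ext_subfield:
  assumes K: "complex_subfield K" and r: "r ^ 2 \<in> K"
  shows "complex_subfield (quad_ext K r)"
proof (cases "r \<in> K")
  case True
  thus ?thesis using K quad_ext_trivial by simp
next
  case False
  note [intro] = complex_subfieldD[OF K]
  have inv: "inverse (x + y * r) \<in> quad_ext K r" if xy: "x \<in> K" "y \<in> K" for x y
  proof (cases "x = 0 \<and> y = 0")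
    case True
    thus ?thesis using quad_extI[of 0 K 0 r] by auto
  next
    case nz: False
    \<comment> \<open>The norm of \<open>x + y * r\<close>. Both of its factors are non-zero because
      \<open>r \<notin> K\<close>, and the inverse is the conjugate divided by the norm.\<close>
    define N where "N = x ^ 2 - y ^ 2 * r ^ 2"
    have N: "N \<in> K" using xy r unfolding N_def by blast
    have fac: "N = (x + y * r) * (x - y * r)"
      by (simp add: N_def power2_eq_square algebra_simps)
    have ne: "x + c * r \<noteq> 0" if c: "c = y \<or> c = - y" for c
    proof
      assume 0: "x + c * r = 0"
      show False
      proof (cases "y = 0")
        case True thus False using 0 c nz by auto
      next
        case y: False
        hence "c \<noteq> 0" using c by auto
        moreover have "c * r = - x" using 0 by (simp add: eq_neg_iff_add_eq_0 add.commute)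
        ultimately have "r = - x / c" by (simp add: field_simps)
        moreover have "- x / c \<in> K" using xy c by blast
        ultimately show False using False by simp
      qed
    qed
    have N0: "N \<noteq> 0" using ne[of y] ne[of "- y"] unfolding fac by simp
    have "inverse (x + y * r) = x / N + (- y / N) * r"
    proof -
      have "x / N + (- y / N) * r = (x - y * r) / N" by (simp add: diff_divide_distrib)
      also have "\<dots> = inverse (x + y * r)"
        using ne[of "- y"] unfolding fac by (simp add: divide_inverse)
      finally show ?thesis by simp
    qed
    moreover have "x / N \<in> K" "- y / N \<in> K" using xy N by blast+
    ultimately show ?thesis using quad_extI by metis
  qed
  have neg: "- (x + y * r) \<in> quad_ext K r" if "x \<in> K" "y \<in> K" for x y
    using quad_extI[of "- x" K "- y" r] that by auto
  have add: "(x + y * r) + (x' + y' * r) \<in> quad_ext K r"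
    if "x \<in> K" "y \<in> K" "x' \<in> K" "y' \<in> K" for x y x' y'
    using quad_extI[of "x + x'" K "y + y'" r] that by (auto simp: algebra_simps)
  have mult: "(x + y * r) * (x' + y' * r) \<in> quad_ext K r"
    if "x \<in> K" "y \<in> K" "x' \<in> K" "y' \<in> K" for x y x' y'
  proof -
    have "(x + y * r) * (x' + y' * r) = (x * x' + y * y' * r ^ 2) + (x * y' + y * x') * r"
      by (simp add: power2_eq_square algebra_simps)
    moreover have "x * x' + y * y' * r ^ 2 \<in> K" "x * y' + y * x' \<in> K" using that r by blast+
    ultimately show ?thesis using quad_extI by metis
  qed
  have "1 \<in> quad_ext K r" using quad_ext_superset[OF K] by auto
  moreover have "- u \<in> quad_ext K r \<and> inverse u \<in> quad_ext K r" if u: "u \<in> quad_ext K r" for u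
  proof -
    obtain x y where "u = x + y * r" "x \<in> K" "y \<in> K" using u unfolding quad_ext_def by auto
    thus ?thesis using inv neg by blast
  qed
  moreover have "u + v \<in> quad_ext K r \<and> u * v \<in> quad_ext K r"
    if uv: "u \<in> quad_ext K r" "v \<in> quad_ext K r" for u v
  proof -
    obtain x y x' y' where "u = x + y * r" "v = x' + y' * r" "x \<in> K" "y \<in> K" "x' \<in> K" "y' \<in> K"
      using uv unfolding quad_ext_def by blast
    thus ?thesis using add mult by metis
  qed
  ultimately show ?thesis unfolding complex_subfield_def by blast
qed

text \<open>For \<open>r \<notin> K\<close> the coefficients of \<open>x + y * r\<close> are unique,
  and any square root \<open>s\<close> of \<open>\<sigma> (r ^ 2)\<close> may serve as the image of
  \<open>r\<close>. For \<open>r \<in> K\<close> the image is already determined and has to agree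
  with \<open>s\<close>, which is the last assumption.\<close>

lemma quad_ext_embedding:
  assumes K: "complex_subfield K" and h: "field_embedding K \<sigma>"
    and r: "r ^ 2 \<in> K" "\<sigma> (r ^ 2) = s ^ 2" and rs: "r \<in> K \<Longrightarrow> \<sigma> r = s"
  obtains \<tau> where "field_embedding (quad_ext K r) \<tau>" "\<And>x. x \<in> K \<Longrightarrow> \<tau> x = \<sigma> x" "\<tau> r = s"
proof (cases "r \<in> K")
  case True
  thus ?thesis using that[of \<sigma>] rs h quad_ext_trivial[OF K True] by auto
next
  case False
  note [intro] = complex_subfieldD[OF K]
  note hom = field_embeddingD[OF K h]
  have uniq: "x = x' \<and> y = y'" if "x + y * r = x' + y' * r" "x \<in> K" "y \<in> K" "x' \<in> K" "y' \<in> K"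
    for x y x' y'
  proof (cases "y = y'")
    case ne: False
    have "(y - y') * r = x' - x" using that(1) by (simp add: algebra_simps)
    hence "r = (x' - x) / (y - y')" using ne by (simp add: field_simps)
    hence "r \<in> K" using that by auto
    thus ?thesis using False by blast
  qed (use that in auto)
  define \<tau> where "\<tau> u = (THE v. \<exists>x y. x \<in> K \<and> y \<in> K \<and> u = x + y * r \<and> v = \<sigma> x + \<sigma> y * s)" for u
  have \<tau>: "\<tau> (x + y * r) = \<sigma> x + \<sigma> y * s" if "x \<in> K" "y \<in> K" for x y
    unfolding \<tau>_def
    by (rule the_equality) (use that uniq in blast)+
  have "field_embedding (quad_ext K r) \<tau>"
    unfolding field_embedding_def
  proof (intro conjI ballI)
    have "(1::complex) = 1 + 0 * r" by simp
    thus "\<tau> 1 = 1" using \<tau>[of 1 0] hom(1,2) by auto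
    fix u v assume "u \<in> quad_ext K r" "v \<in> quad_ext K r"
    then obtain x y x' y' where uv: "u = x + y * r" "v = x' + y' * r"
      and K: "x \<in> K" "y \<in> K" "x' \<in> K" "y' \<in> K"
      unfolding quad_ext_def by blast
    have "u + v = (x + x') + (y + y') * r" unfolding uv by (simp add: algebra_simps)
    moreover have "\<tau> \<dots> = \<sigma> (x + x') + \<sigma> (y + y') * s" by (rule \<tau>) (use K in blast)+
    ultimately show "\<tau> (u + v) = \<tau> u + \<tau> v"
      unfolding uv \<tau>[OF K(1,2)] \<tau>[OF K(3,4)] using K hom(3) by (simp add: algebra_simps)
    have "u * v = (x * x' + y * y' * r ^ 2) + (x * y' + y * x') * r"
      unfolding uv by (simp add: power2_eq_square algebra_simps)
    moreover have "\<tau> \<dots> = \<sigma> (x * x' + y * y' * r ^ 2) + \<sigma> (x * y' + y * x') * s"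
      by (rule \<tau>) (use K r in blast)+
    moreover have "\<sigma> (x * x' + y * y' * r ^ 2) = \<sigma> x * \<sigma> x' + \<sigma> y * \<sigma> y' * s ^ 2"
    proof -
      have "x * x' \<in> K" "y * y' \<in> K" "y * y' * r ^ 2 \<in> K" using K r by blast+
      thus ?thesis using hom(3,4) K r by metis
    qed
    moreover have "\<sigma> (x * y' + y * x') = \<sigma> x * \<sigma> y' + \<sigma> y * \<sigma> x'"
    proof -
      have "x * y' \<in> K" "y * x' \<in> K" using K r by blast+
      thus ?thesis using hom(3,4) K by metis
    qed
    ultimately have "\<tau> (u * v) = (\<sigma> x * \<sigma> x' + \<sigma> y * \<sigma> y' * s ^ 2) + (\<sigma> x * \<sigma> y' + \<sigma> y * \<sigma> x') * s"
      by metis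
    also have "\<dots> = (\<sigma> x + \<sigma> y * s) * (\<sigma> x' + \<sigma> y' * s)"
      by (simp add: power2_eq_square algebra_simps)
    also have "\<dots> = \<tau> u * \<tau> v" unfolding uv using \<tau> K by metis
    finally show "\<tau> (u * v) = \<tau> u * \<tau> v" .
  qed
  moreover have "\<tau> x = \<sigma> x" if "x \<in> K" for x
    using \<tau>[of x 0] that hom(2) by auto
  moreover have "\<tau> r = s" using \<tau>[of 0 1] hom(1,2) by auto
  ultimately show ?thesis using that by blast
qed

section \<open>Generated fields and Kummer theory\<close>

abbreviation gen_field :: "complex set \<Rightarrow> complex set" where
  "gen_field A \<equiv> generate_field ring_of_type_algebra A"

lemma ring_of_type_algebra_complex [simp]:
  "carrier (ring_of_type_algebra :: complex ring) = UNIV"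
  "x \<oplus>\<^bsub>ring_of_type_algebra\<^esub> y = (x + y :: complex)"
  "x \<otimes>\<^bsub>ring_of_type_algebra\<^esub> y = (x * y :: complex)"
  "\<one>\<^bsub>ring_of_type_algebra\<^esub> = (1 :: complex)"
  "\<zero>\<^bsub>ring_of_type_algebra\<^esub> = (0 :: complex)"
  by (simp_all add: ring_of_type_algebra_def)

lemma ring_of_type_algebra_uminus [simp]: "\<ominus>\<^bsub>ring_of_type_algebra\<^esub> x = (- x :: complex)"
  using abelian_group.minus_equality[OF ring.is_abelian_group[OF ring_from_type_algebra], of "- x" x] by simp

lemma ring_of_type_algebra_inverse [simp]:
  assumes "x \<noteq> 0"
  shows "inv\<^bsub>ring_of_type_algebra\<^esub> x = (inverse x :: complex)"
  by (rule comm_monoid.comm_inv_char[OF cring.axioms(2)[OF cring_from_type_algebra]])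
     (use assms in simp_all)

lemma gen_field_incl: "A \<subseteq> gen_field A"
  by (auto intro: generate_field.incl)

lemma gen_field_subfield: "complex_subfield (gen_field A)"
proof -
  have 1: "1 \<in> gen_field A" using generate_field.one[of ring_of_type_algebra A] by simp
  have neg: "- x \<in> gen_field A" if "x \<in> gen_field A" for x
    using generate_field.a_inv[OF that] by simp
  have add: "x + y \<in> gen_field A" if "x \<in> gen_field A" "y \<in> gen_field A" for x y
    using generate_field.eng_add[OF that] by simp
  have mult: "x * y \<in> gen_field A" if "x \<in> gen_field A" "y \<in> gen_field A" for x y
    using generate_field.eng_mult[OF that] by simp
  have inv: "inverse x \<in> gen_field A" if "x \<in> gen_field A" for x
  proof (cases "x = 0")
    case False
    thus ?thesis using generate_field.m_inv[OF that] by simp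
  qed (use that in simp)
  show ?thesis unfolding complex_subfield_def by (intro conjI ballI 1 neg add mult inv)
qed

lemma gen_field_least:
  assumes K: "complex_subfield K" and "A \<subseteq> K"
  shows "gen_field A \<subseteq> K"
proof
  fix x assume "x \<in> gen_field A"
  thus "x \<in> K"
  proof (induction rule: generate_field.induct)
    case (m_inv h)
    thus ?case using complex_subfieldD(4)[OF K] by simp
  qed (use \<open>A \<subseteq> K\<close> complex_subfieldD(1,3,5,6)[OF K] in auto)
qed

lemma gen_field_mono: "A \<subseteq> B \<Longrightarrow> gen_field A \<subseteq> gen_field B"
  using gen_field_least[OF gen_field_subfield, of A B] gen_field_incl[of B] by blast

lemma gen_field_insert:
  assumes "r ^ 2 \<in> gen_field A"
  shows "gen_field (insert r A) = quad_ext (gen_field A) r"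
proof
  note sf = gen_field_subfield
  show "gen_field (insert r A) \<subseteq> quad_ext (gen_field A) r"
    using quad_ext_superset[OF sf[of A], of r] gen_field_incl[of A]
    by (intro gen_field_least quad_ext_subfield sf assms) blast
  have "gen_field A \<subseteq> gen_field (insert r A)" by (rule gen_field_mono) auto
  moreover have "r \<in> gen_field (insert r A)" using gen_field_incl by blast
  ultimately show "quad_ext (gen_field A) r \<subseteq> gen_field (insert r A)"
    unfolding quad_ext_def by (auto intro!: complex_subfieldD[OF sf])
qed

text \<open>Modulo the base field every \<open>r a\<close> is its own inverse, so the conclusion
  says that \<open>w\<close> is a product of roots up to a factor from \<open>gen_field A\<close>.
  Adjoin the roots one at a time: if \<open>w = x + y * r a\<close> lies outside the smaller field,
  then \<open>w ^ 2\<close> forces \<open>2 * x * y * r a\<close> into it, hence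
  \<open>x = 0\<close>, and the induction hypothesis applies to \<open>y\<close>.\<close>

lemma kummer:
  assumes "finite T" "\<And>a. a \<in> T \<Longrightarrow> r a ^ 2 \<in> gen_field A" "\<And>a. a \<in> T \<Longrightarrow> r a \<noteq> 0"
    and "w \<in> gen_field (r ` T \<union> A)" "w ^ 2 \<in> gen_field A"
  obtains U where "U \<subseteq> T" "w * (\<Prod>a\<in>U. r a) \<in> gen_field A"
proof -
  have "\<exists>U\<subseteq>T. w * (\<Prod>a\<in>U. r a) \<in> gen_field A"
    using assms
  proof (induction T arbitrary: w rule: finite_induct)
    case empty
    thus ?case by simp
  next
    case (insert a T)
    let ?F = "gen_field (r ` T \<union> A)"
    note F = complex_subfieldD[OF gen_field_subfield[of "r ` T \<union> A"]]
    note A = complex_subfieldD[OF gen_field_subfield[of A]]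
    have sub: "gen_field A \<subseteq> ?F" by (rule gen_field_mono) auto
    have ra: "r a ^ 2 \<in> ?F" "r a ^ 2 \<in> gen_field A" "r a \<noteq> 0" using insert.prems sub by auto
    have eq: "gen_field (r ` insert a T \<union> A) = quad_ext ?F (r a)"
      using gen_field_insert[OF ra(1)] by simp
    obtain x y where w: "w = x + y * r a" "x \<in> ?F" "y \<in> ?F"
      using insert.prems(3) unfolding eq quad_ext_def by blast
    have IH: "\<exists>U\<subseteq>T. v * (\<Prod>a\<in>U. r a) \<in> gen_field A" if "v \<in> ?F" "v ^ 2 \<in> gen_field A" for v
      using insert.IH[OF _ _ that] insert.prems(1,2) by auto
    show ?case
    proof (cases "w \<in> ?F")
      case True
      thus ?thesis using IH[OF True insert.prems(4)] by blast
    next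
      case False
      hence "r a \<notin> ?F" "y \<noteq> 0" using w F(5)[OF w(2) F(6)[OF w(3)]] by auto
      have "w ^ 2 = (x ^ 2 + y ^ 2 * r a ^ 2) + 2 * x * y * r a"
        unfolding w by (simp add: power2_eq_square algebra_simps)
      hence *: "2 * x * y * r a = w ^ 2 - (x ^ 2 + y ^ 2 * r a ^ 2)" by simp
      have "w ^ 2 \<in> ?F" using insert.prems(4) sub by blast
      hence "2 * x * y * r a \<in> ?F" unfolding *
        using w ra(1) by (intro F(7) F(5) F(6)) (auto intro: F(9))
      have "x = 0"
      proof (rule ccontr)
        assume "x \<noteq> 0"
        have "2 * x * y \<in> ?F" using F(6)[OF F(6)[OF F(11)[of 2] w(2)] w(3)] by simp
        hence "(2 * x * y * r a) / (2 * x * y) \<in> ?F" using \<open>2 * x * y * r a \<in> ?F\<close> by (rule F(8)[rotated])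
        thus False using \<open>x \<noteq> 0\<close> \<open>y \<noteq> 0\<close> \<open>r a \<notin> ?F\<close> by simp
      qed
      hence wy: "w = y * r a" using w by simp
      have "y ^ 2 = w ^ 2 / r a ^ 2" unfolding wy using ra by (simp add: power_mult_distrib)
      hence "y ^ 2 \<in> gen_field A" using A(8)[OF insert.prems(4) ra(2)] by simp
      then obtain U where U: "U \<subseteq> T" "y * (\<Prod>a\<in>U. r a) \<in> gen_field A" using IH w by blast
      have "finite U" "a \<notin> U" using U insert.hyps finite_subset by auto
      \<comment> \<open>With \<open>w = y * r a\<close>, inserting \<open>a\<close> produces the
        square \<open>r a ^ 2\<close>, which belongs to the base field.\<close>
      hence "w * (\<Prod>a\<in>insert a U. r a) = (y * (\<Prod>a\<in>U. r a)) * r a ^ 2"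
        unfolding wy by (simp add: power2_eq_square)
      hence "w * (\<Prod>a\<in>insert a U. r a) \<in> gen_field A" using A(6)[OF U(2) ra(2)] by simp
      thus ?thesis using U by blast
    qed
  qed
  thus ?thesis using that by blast
qed

section \<open>The cyclotomic field and its embeddings\<close>

context root_of_unity
begin

text \<open>A non-zero \<open>p\<close> of minimal degree with \<open>p(z) \<in> u(z) \<int>[z]\<close> is constant: pseudo-dividing the
  minimal polynomial \<open>h\<close> by \<open>p\<close> leaves no remainder, so \<open>h\<close> divides \<open>p\<close> or the cofactor; the
  former is impossible because the remainder of \<open>u\<close> modulo \<open>h\<close> has smaller degree.\<close>

lemma ipoly_dvd_int:
  assumes u: "ipoly u z \<noteq> 0"
  obtains t c where "c \<noteq> 0" "ipoly u z * ipoly t z = of_int c"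
proof -
  obtain h where h: "lead_coeff h = 1" "ipoly h z = 0" "\<And>u. ipoly u z = 0 \<Longrightarrow> h dvd u"
    using minimal_polynomial by blast
  define I where "I p \<longleftrightarrow> p \<noteq> 0 \<and> (\<exists>t. ipoly p z = ipoly u z * ipoly t z)" for p
  have "I u" unfolding I_def using u by (auto intro: exI[of _ 1])
  then obtain p where p: "I p" and min: "\<And>q. I q \<Longrightarrow> Polynomial.degree p \<le> Polynomial.degree q"
    using ex_has_least_nat[of I u Polynomial.degree] by blast
  obtain t where t: "ipoly p z = ipoly u z * ipoly t z" and "p \<noteq> 0" using p by (auto simp: I_def)
  obtain a q where aq: "a \<noteq> 0" "Polynomial.smult a h = p * q + pseudo_mod h p"
    using pseudo_mod(1)[OF \<open>p \<noteq> 0\<close>] by blast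
  have "ipoly (pseudo_mod h p) z = - (ipoly p z * ipoly q z)"
    using arg_cong[OF aq(2), of "\<lambda>p. ipoly p z"] h(2) by (simp add: eq_neg_iff_add_eq_0 add.commute)
  also have "\<dots> = ipoly u z * ipoly (- (t * q)) z" unfolding t by simp
  finally have "pseudo_mod h p = 0"
    using pseudo_mod(2)[OF \<open>p \<noteq> 0\<close>, of h] min unfolding I_def by (metis not_le)
  hence pq: "Polynomial.smult a h = p * q" using aq by simp
  have h0: "h \<noteq> 0" using h(1) by auto
  have q0: "q \<noteq> 0" using pq aq(1) h0 by auto
  have deg: "Polynomial.degree h = Polynomial.degree p + Polynomial.degree q"
    using arg_cong[OF pq, of Polynomial.degree] aq(1) \<open>p \<noteq> 0\<close> q0
    by (simp add: Polynomial.degree_mult_eq)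
  have "ipoly p z \<noteq> 0"
  proof
    assume "ipoly p z = 0"
    hence le: "Polynomial.degree h \<le> Polynomial.degree p"
      using h(3) \<open>p \<noteq> 0\<close> dvd_imp_degree_le by blast
    obtain g r where gr: "u = h * g + r" "r = 0 \<or> Polynomial.degree r < Polynomial.degree h"
      using monic_division[OF h(1)] by blast
    have "ipoly r z = ipoly u z" using h(2) unfolding gr(1) by simp
    hence "I r" using u unfolding I_def by (auto intro: exI[of _ 1])
    thus False using min[of r] gr(2) le unfolding I_def by auto
  qed
  moreover have "ipoly p z * ipoly q z = 0"
    using arg_cong[OF pq, of "\<lambda>p. ipoly p z"] h(2) by simp
  ultimately have "ipoly q z = 0" by simp
  hence "Polynomial.degree h \<le> Polynomial.degree q" using h(3) q0 dvd_imp_degree_le by blast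
  hence "Polynomial.degree p = 0" using deg by simp
  then obtain c where c: "p = [:c:]" by (rule degree_eq_zeroE)
  hence "c \<noteq> 0" using \<open>p \<noteq> 0\<close> by simp
  thus ?thesis using that[of c t] t unfolding c by simp
qed

abbreviation cyc_field :: "complex set" where
  "cyc_field \<equiv> gen_field (insert z \<rat>)"

lemma z_in_cyc_field: "z \<in> cyc_field"
  using gen_field_incl by blast

lemma ipoly_in_cyc_field: "ipoly u z \<in> cyc_field"
proof (induction u)
  case (pCons a u)
  note K = complex_subfieldD[OF gen_field_subfield[of "insert z \<rat>"]]
  from K(5)[OF K(11) K(6)[OF z_in_cyc_field pCons.IH]] show ?case by simp
qed (use complex_subfieldD(2)[OF gen_field_subfield] in simp)

text \<open>Integer numerators over a natural denominator let the results on
  \<open>\<int>[z]\<close> speak about the whole field. Closure under inverses comes from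
  \<open>ipoly_dvd_int\<close>: some multiple of a non-zero numerator is a non-zero integer.\<close>

lemma cyc_field_eq: "cyc_field = {ipoly u z / of_nat c |u c. c > 0}" (is "_ = ?F")
proof
  have I: "ipoly u z / of_nat c \<in> ?F" if "c > 0" for u c using that by blast
  have "complex_subfield ?F"
    unfolding complex_subfield_def
  proof (intro conjI ballI)
    show "1 \<in> ?F" using I[of 1 1] by simp
    fix x assume "x \<in> ?F"
    then obtain u c where x: "x = ipoly u z / of_nat c" "c > 0" by blast
    show "- x \<in> ?F" using I[of c "- u"] x by simp
    show "inverse x \<in> ?F"
    proof (cases "ipoly u z = 0")
      case True
      thus ?thesis using I[of 1 0] x by simp
    next
      case False
      obtain t m where t: "m \<noteq> 0" "ipoly u z * ipoly t z = of_int m" using ipoly_dvd_int[OF False] by blast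
      \<comment> \<open>Denominators are positive naturals, so the sign of \<open>m\<close> is moved
        into the numerator.\<close>
      have m: "of_nat (nat \<bar>m\<bar>) = (of_int (sgn m * m) :: complex)" by (simp add: sgn_mult_self_eq mult.commute flip: abs_sgn)
      have "inverse x = of_nat c * ipoly t z / of_int m"
        unfolding x t(2)[symmetric] using False t by (auto simp: field_simps)
      also have "\<dots> = ipoly (Polynomial.smult (sgn m * int c) t) z / of_nat (nat \<bar>m\<bar>)"
        unfolding m using t(1) by (simp add: sgn_if field_simps)
      also have "\<dots> \<in> ?F" by (rule I) (use t(1) in simp)
      finally show ?thesis .
    qed
    fix y assume "y \<in> ?F"
    then obtain v c' where y: "y = ipoly v z / of_nat c'" "c' > 0" by blast
    have "x + y = ipoly (Polynomial.smult (int c') u + Polynomial.smult (int c) v) z / of_nat (c * c')"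
      using x y by (simp add: field_simps)
    also have "\<dots> \<in> ?F" by (rule I) (use x y in simp)
    finally show "x + y \<in> ?F" .
    have "x * y = ipoly (u * v) z / of_nat (c * c')" using x y by simp
    also have "\<dots> \<in> ?F" by (rule I) (use x y in simp)
    finally show "x * y \<in> ?F" .
  qed
  moreover have "z \<in> ?F" using I[of 1 "Polynomial.monom 1 1"] by simp
  ultimately show "cyc_field \<subseteq> ?F"
    using complex_subfield_Rats by (intro gen_field_least) auto
  show "?F \<subseteq> cyc_field"
    by (auto intro!: complex_subfieldD(8,10)[OF gen_field_subfield] ipoly_in_cyc_field)
qed

text \<open>Two fractions for the same element amount, after clearing denominators, to an integer
  relation at \<open>z\<close>. By \<open>conjugate_root\<close> it also holds at
  \<open>z ^ f\<close>, so substituting \<open>z ^ f\<close> for \<open>z\<close> is well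
  defined.\<close>

lemma cyc_embedding:
  assumes f: "coprime f d" "f > 0"
  obtains \<sigma> where "field_embedding cyc_field \<sigma>" "\<And>u. \<sigma> (ipoly u z) = ipoly u (z ^ f)"
proof -
  define \<sigma> where "\<sigma> x = (THE y. \<exists>u c. c > 0 \<and> x = ipoly u z / of_nat c \<and> y = ipoly u (z ^ f) / of_nat c)" for x
  have \<sigma>: "\<sigma> (ipoly u z / of_nat c) = ipoly u (z ^ f) / of_nat c" if c: "c > 0" for u c
    unfolding \<sigma>_def
  proof (rule the_equality)
    show "\<exists>u' c'. c' > 0 \<and> ipoly u z / of_nat c = ipoly u' z / of_nat c' \<and>
      ipoly u (z ^ f) / of_nat c = ipoly u' (z ^ f) / of_nat c'"
      by (intro exI[of _ u] exI[of _ c] conjI c refl)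
    fix y assume "\<exists>u' c'. c' > 0 \<and> ipoly u z / of_nat c = ipoly u' z / of_nat c' \<and> y = ipoly u' (z ^ f) / of_nat c'"
    then obtain u' c' where c': "c' > 0" "ipoly u z / of_nat c = ipoly u' z / of_nat c'"
      "y = ipoly u' (z ^ f) / of_nat c'" by blast
    have "ipoly (Polynomial.smult (int c') u - Polynomial.smult (int c) u') z = 0"
      using c'(1,2) c by (simp add: frac_eq_eq mult.commute)
    from conjugate_root[OF f this] show "y = ipoly u (z ^ f) / of_nat c"
      unfolding c'(3) using c'(1) c by (simp add: frac_eq_eq mult.commute)
  qed
  have "\<sigma> (ipoly u z) = ipoly u (z ^ f)" for u using \<sigma>[of 1 u] by simp
  moreover have "field_embedding cyc_field \<sigma>"
    unfolding field_embedding_def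
  proof (intro conjI ballI)
    show "\<sigma> 1 = 1" using \<sigma>[of 1 1] by simp
    fix x y assume "x \<in> cyc_field" "y \<in> cyc_field"
    then obtain u v c c' where x: "x = ipoly u z / of_nat c" "c > 0"
      and y: "y = ipoly v z / of_nat c'" "c' > 0" unfolding cyc_field_eq by blast
    have pos: "c * c' > 0" using x(2) y(2) by simp
    let ?w = "Polynomial.smult (int c') u + Polynomial.smult (int c) v"
    have add: "x + y = ipoly ?w z / of_nat (c * c')"
      unfolding x(1) y(1) using x(2) y(2) by (simp add: add_frac_eq mult.commute)
    have "\<sigma> (x + y) = ipoly ?w (z ^ f) / of_nat (c * c')"
      unfolding add by (rule \<sigma>[OF pos])
    also have "\<dots> = \<sigma> x + \<sigma> y"
      unfolding x(1) y(1) \<sigma>[OF x(2)] \<sigma>[OF y(2)] using x(2) y(2) by (simp add: add_frac_eq mult.commute)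
    finally show "\<sigma> (x + y) = \<sigma> x + \<sigma> y" .
    have mult: "x * y = ipoly (u * v) z / of_nat (c * c')" unfolding x(1) y(1) by simp
    have "\<sigma> (x * y) = ipoly (u * v) (z ^ f) / of_nat (c * c')"
      unfolding mult by (rule \<sigma>[OF pos])
    also have "\<dots> = \<sigma> x * \<sigma> y"
      unfolding x(1) y(1) \<sigma>[OF x(2)] \<sigma>[OF y(2)] by simp
    finally show "\<sigma> (x * y) = \<sigma> x * \<sigma> y" .
  qed
  ultimately show ?thesis using that by blast
qed

end

section \<open>Square roots over the cyclotomic field and the relations in
  \<open>D0_sets\<close>\<close>

locale kummer_extension = root_of_unity +
  fixes S :: "int set" and r :: "int \<Rightarrow> complex"
  assumes S: "finite S" "0 \<notin> S" and d8: "8 dvd d"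
    and r_square: "a \<in> S \<Longrightarrow> (r a)\<^sup>2 = of_int a"
begin

lemma r_nonzero: "a \<in> S \<Longrightarrow> r a \<noteq> 0"
  using r_square[of a] S(2) by auto

lemma sqf_set_decompose:
  assumes "U \<subseteq> S"
  obtains k :: int where "k \<noteq> 0" "(\<Prod>a\<in>U. r a)\<^sup>2 = of_int (sqf_set U * k ^ 2)" "squarefree (sqf_set U)"
proof -
  have "(\<Prod>a\<in>U. r a)\<^sup>2 = (\<Prod>a\<in>U. (r a)\<^sup>2)" by (rule prod_power_distrib)
  also have "\<dots> = (\<Prod>a\<in>U. of_int a)" using assms r_square by (intro prod.cong) auto
  finally have 1: "(\<Prod>a\<in>U. r a)\<^sup>2 = of_int (\<Prod>a\<in>U. a)" by simp
  have 2: "(\<Prod>a\<in>U. a) \<noteq> 0" using assms S finite_subset by (subst prod_zero_iff) auto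
  have 3: "(\<Prod>a\<in>U. a) = sqf_set U * square_part (\<Prod>a\<in>U. a) ^ 2"
    unfolding sqf_set_def by (rule squarefree_decompose)
  have 4: "squarefree (sqf_set U)" using 2 unfolding sqf_set_def by simp
  have "square_part (\<Prod>a\<in>U. a) \<noteq> 0" using 2 3 by auto
  thus ?thesis using that 1 3 4 by metis
qed

text \<open>Clearing the denominator \<open>c\<close> turns the product into an element of
  \<open>\<int>[z]\<close> whose square is the squarefree part times a positive square, as
  \<open>sqrt_conductor\<close> demands.\<close>

lemma D0_sets_if_prod_in_cyc_field:
  assumes U: "U \<subseteq> S" and y: "(\<Prod>a\<in>U. r a) \<in> cyc_field"
  shows "U \<in> D0_sets d S"
proof -
  obtain k where k: "k \<noteq> 0" "(\<Prod>a\<in>U. r a)\<^sup>2 = of_int (sqf_set U * k ^ 2)" "squarefree (sqf_set U)"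
    using sqf_set_decompose[OF U] by blast
  obtain u c where u: "(\<Prod>a\<in>U. r a) = ipoly u z / of_nat c" "c > 0"
    using y unfolding cyc_field_eq by blast
  have "(ipoly u z)\<^sup>2 = of_nat c ^ 2 * (\<Prod>a\<in>U. r a)\<^sup>2"
    using u by (simp add: power_divide)
  hence "(ipoly u z)\<^sup>2 = of_int (int (c * nat \<bar>k\<bar>) ^ 2 * sqf_set U)"
    unfolding k(2) by (simp add: power_mult_distrib)
  hence "sqf_set U dvd int d"
    by (rule sqrt_conductor) (use u(2) k in auto)
  thus ?thesis using U by (simp add: D0_sets_def)
qed

text \<open>The squarefree part has a square root in \<open>\<int>[z]\<close>, and the product of
  the roots is an integer multiple of it. The polynomial \<open>v\<close> is fixed before
  \<open>f\<close>.\<close>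

lemma D0_sets_conjugate:
  assumes U: "U \<in> D0_sets d S"
  obtains v where "(\<Prod>a\<in>U. r a) = ipoly v z"
    "\<And>f. coprime f d \<Longrightarrow> f > 0 \<Longrightarrow> ipoly v (z ^ f) = of_int (Jacobi (sqf_set U) (int f)) * ipoly v z"
proof -
  have US: "U \<subseteq> S" and dvd: "sqf_set U dvd int d" using U by (auto simp: D0_sets_def)
  obtain k where k: "k \<noteq> 0" "(\<Prod>a\<in>U. r a)\<^sup>2 = of_int (sqf_set U * k ^ 2)" "squarefree (sqf_set U)"
    using sqf_set_decompose[OF US] by blast
  obtain x where "x \<in> int_span" "x ^ 2 = of_int (sqf_set U)"
    using sqrt_in_int_span[OF d8 dvd k(3)] by blast
  then obtain w where w: "(ipoly w z)\<^sup>2 = of_int (sqf_set U)" by blast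
  have "(\<Prod>a\<in>U. r a)\<^sup>2 = (of_int k * ipoly w z)\<^sup>2"
    unfolding k(2) by (simp add: power_mult_distrib w)
  \<comment> \<open>Equal squares: \<open>m\<close> is \<open>k\<close> or
    \<open>-k\<close>.\<close>
  then obtain m :: int where m: "(\<Prod>a\<in>U. r a) = of_int m * ipoly w z"
    unfolding power2_eq_iff by (metis mult_minus_left of_int_minus)
  have "even d" using d8 by (rule dvd_trans[rotated]) simp
  have "ipoly (Polynomial.smult m w) (z ^ f) = of_int (Jacobi (sqf_set U) (int f)) * ipoly (Polynomial.smult m w) z"
    if "coprime f d" "f > 0" for f
    using sqrt_conjugate[OF that \<open>even d\<close> w dvd] by simp
  thus ?thesis using that[of "Polynomial.smult m w"] m by simp
qed

text \<open>Adjoin the roots one at a time; a new root accepts either sign. If \<open>r a\<close>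
  already lies in the field, \<open>kummer\<close> gives a set \<open>U\<close> of earlier elements
  such that \<open>insert a U\<close> belongs to \<open>D0_sets d S\<close>. Computing the image of
  the product over this set from the roots and from \<open>z ^ f\<close> determines the sign of
  \<open>r a\<close> as \<open>J * \<Theta>\<close>, and the equation \<open>D0\<close> identifies
  it with \<open>\<theta> a\<close>.\<close>

lemma embedding_exists:
  assumes f: "coprime f d" "f > 0" and \<theta>: "\<And>a. a \<in> S \<Longrightarrow> \<theta> a \<in> {1, -1 :: int}"
    and D0: "\<And>U. U \<in> D0_sets d S \<Longrightarrow> (\<Prod>a\<in>U. \<theta> a) * Jacobi (sqf_set U) (int f) = 1"
  obtains \<sigma> where "field_embedding (gen_field (r ` S \<union> insert z \<rat>)) \<sigma>" "\<sigma> z = z ^ f"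
    "\<And>a. a \<in> S \<Longrightarrow> \<sigma> (r a) = of_int (\<theta> a) * r a"
proof -
  \<comment> \<open>The induction carries the values on all of \<open>\<int>[z]\<close>, because the
    products over sets in \<open>D0_sets d S\<close> are handled as
    \<open>ipoly v z\<close>.\<close>
  have "\<exists>\<sigma>. field_embedding (gen_field (r ` T \<union> insert z \<rat>)) \<sigma> \<and>
      (\<forall>u. \<sigma> (ipoly u z) = ipoly u (z ^ f)) \<and> (\<forall>a\<in>T. \<sigma> (r a) = of_int (\<theta> a) * r a)"
    if "T \<subseteq> S" for T
    using finite_subset[OF that S(1)] that
  proof (induction T rule: finite_induct)
    case empty
    obtain \<sigma> where "field_embedding cyc_field \<sigma>" "\<And>u. \<sigma> (ipoly u z) = ipoly u (z ^ f)"
      using cyc_embedding[OF f] by blast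
    thus ?case by auto
  next
    case (insert a T)
    let ?K = "gen_field (r ` T \<union> insert z \<rat>)"
    have T: "T \<subseteq> S" and a: "a \<in> S" using insert.prems by auto
    obtain \<sigma> where \<sigma>: "field_embedding ?K \<sigma>" "\<And>u. \<sigma> (ipoly u z) = ipoly u (z ^ f)"
      "\<And>b. b \<in> T \<Longrightarrow> \<sigma> (r b) = of_int (\<theta> b) * r b"
      using insert.IH T by blast
    note K = complex_subfieldD[OF gen_field_subfield[of "r ` T \<union> insert z \<rat>"]]
    note hom = field_embeddingD[OF gen_field_subfield \<sigma>(1)]
    have rT: "r b \<in> ?K" if "b \<in> T" for b
      by (rule subsetD[OF gen_field_incl]) (use that in simp)
    have sub: "cyc_field \<subseteq> ?K" by (rule gen_field_mono) auto
    have sq: "(r a)\<^sup>2 \<in> ?K" "\<sigma> ((r a)\<^sup>2) = (of_int (\<theta> a) * r a)\<^sup>2"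
      unfolding power_mult_distrib r_square[OF a] hom(10) by (rule K(11)) (use \<theta>[OF a] in auto)
    have "\<sigma> (r a) = of_int (\<theta> a) * r a" if "r a \<in> ?K"
    proof -
      have "\<exists>U\<subseteq>T. r a * (\<Prod>b\<in>U. r b) \<in> cyc_field"
      proof (rule kummer[of T r "insert z \<rat>" "r a"])
        show "r b ^ 2 \<in> cyc_field" if "b \<in> T" for b
          unfolding r_square[OF subsetD[OF T that]] by (rule complex_subfieldD(11)[OF gen_field_subfield])
        show "(r a)\<^sup>2 \<in> cyc_field"
          unfolding r_square[OF a] by (rule complex_subfieldD(11)[OF gen_field_subfield])
      qed (use insert.hyps T r_nonzero \<open>r a \<in> ?K\<close> in auto)
      then obtain U where U: "U \<subseteq> T" "r a * (\<Prod>b\<in>U. r b) \<in> cyc_field" by blast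
      have aU: "finite U" "a \<notin> U" using U insert.hyps finite_subset by auto
      let ?V = "insert a U"
      have V: "?V \<in> D0_sets d S"
        by (rule D0_sets_if_prod_in_cyc_field) (use U(1) T a in blast, use U(2) aU in simp)
      obtain v where v: "(\<Prod>b\<in>?V. r b) = ipoly v z"
        "ipoly v (z ^ f) = of_int (Jacobi (sqf_set ?V) (int f)) * ipoly v z"
        using D0_sets_conjugate[OF V] f by blast
      define J where "J = Jacobi (sqf_set ?V) (int f)"
      define R where "R = (\<Prod>b\<in>U. r b)"
      define \<Theta> where "\<Theta> = (\<Prod>b\<in>U. \<theta> b)"
      have RK: "R \<in> ?K" unfolding R_def
        by (rule complex_subfield_prod[OF gen_field_subfield]) (rule rT[OF subsetD[OF U(1)]])
      have "\<sigma> R = (\<Prod>b\<in>U. \<sigma> (r b))" unfolding R_def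
        by (rule field_embedding_prod[OF gen_field_subfield \<sigma>(1)]) (rule rT[OF subsetD[OF U(1)]])
      also have "\<dots> = (\<Prod>b\<in>U. of_int (\<theta> b) * r b)"
        by (rule prod.cong) (use \<sigma>(3) U in auto)
      also have "\<dots> = of_int \<Theta> * R" by (simp add: prod.distrib \<Theta>_def R_def)
      finally have \<sigma>R: "\<sigma> R = of_int \<Theta> * R" .
      have vz: "ipoly v z = r a * R" using v(1) aU by (simp add: R_def)
      have "\<sigma> (r a) * (of_int \<Theta> * R) = of_int J * (r a * R)"
        using \<sigma>(2)[of v] v(2) unfolding vz hom(4)[OF \<open>r a \<in> ?K\<close> RK] \<sigma>R J_def by simp
      moreover have "R \<noteq> 0" unfolding R_def using aU U T r_nonzero by auto
      ultimately have 1: "\<sigma> (r a) * of_int \<Theta> = of_int J * r a" by simp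
      have 2: "\<theta> a * \<Theta> * J = 1" using D0[OF V] aU by (simp add: \<Theta>_def J_def)
      have 3: "\<Theta> = 1 \<or> \<Theta> = -1"
        using aU(1) U(1) T unfolding \<Theta>_def
      proof (induction U rule: finite_induct)
        case (insert b U)
        thus ?case using \<theta>[of b] by auto
      qed simp
      \<comment> \<open>\<open>\<Theta>\<close> is a sign and hence its own inverse.\<close>
      have "\<sigma> (r a) = of_int (J * \<Theta>) * r a"
      proof -
        have "\<sigma> (r a) = (\<sigma> (r a) * of_int \<Theta>) * of_int \<Theta>" using 3 by auto
        thus ?thesis unfolding 1 by (simp add: mult_ac)
      qed
      moreover have "J * \<Theta> = \<theta> a" using 2 3 \<theta>[OF a] by auto
      ultimately show ?thesis by simp
    qed
    then obtain \<tau> where \<tau>: "field_embedding (quad_ext ?K (r a)) \<tau>" "\<And>x. x \<in> ?K \<Longrightarrow> \<tau> x = \<sigma> x"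
      "\<tau> (r a) = of_int (\<theta> a) * r a"
      using quad_ext_embedding[OF gen_field_subfield \<sigma>(1) sq] by blast
    have "quad_ext ?K (r a) = gen_field (r ` insert a T \<union> insert z \<rat>)"
      using gen_field_insert[OF sq(1)] by (simp only: image_insert Un_insert_left)
    moreover have "\<tau> (ipoly u z) = ipoly u (z ^ f)" for u
      unfolding \<tau>(2)[OF subsetD[OF sub ipoly_in_cyc_field]] by (rule \<sigma>(2))
    moreover have "\<tau> (r b) = of_int (\<theta> b) * r b" if "b \<in> insert a T" for b
    proof (cases "b = a")
      case False
      hence "b \<in> T" using that by simp
      show ?thesis unfolding \<tau>(2)[OF rT[OF \<open>b \<in> T\<close>]] by (rule \<sigma>(3)[OF \<open>b \<in> T\<close>])
    qed (simp add: \<tau>(3))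
    ultimately show ?case using \<tau>(1) by auto
  qed
  from this[of S] obtain \<sigma> where \<sigma>: "field_embedding (gen_field (r ` S \<union> insert z \<rat>)) \<sigma>"
      "\<And>u. \<sigma> (ipoly u z) = ipoly u (z ^ f)" "\<And>a. a \<in> S \<Longrightarrow> \<sigma> (r a) = of_int (\<theta> a) * r a" by blast
  have "\<sigma> z = z ^ f" using \<sigma>(2)[of "Polynomial.monom 1 1"] by simp
  thus ?thesis using that \<sigma> by blast
qed

end

section \<open>One root of unity generating several\<close>

lemma primitive_root_of_unity_cis:
  assumes n: "n > 0"
  shows "primitive_root_of_unity n (cis (2 * pi / n))"
proof -
  have pow: "cis (2 * pi / n) ^ m = cis (2 * pi * m / n)" for m
    by (simp add: Complex.DeMoivre mult_ac)
  have "inj_on (\<lambda>k. cis (2 * pi * real k / n)) {..<n}"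
    using bij_betw_roots_unity[OF n] by (rule bij_betw_imp_inj_on)
  hence "cis (2 * pi * real m / n) \<noteq> cis (2 * pi * real 0 / n)" if "0 < m" "m < n" for m
    using that by (auto dest!: inj_onD[where x = m and y = 0])
  hence "cis (2 * pi / n) ^ m \<noteq> 1" if "0 < m" "m < n" for m
    using that unfolding pow by simp
  moreover have "cis (2 * pi / n) ^ n = 1" unfolding pow using n by simp
  ultimately show ?thesis using n by (simp add: primitive_root_of_unity_def)
qed

text \<open>Instead of combining \<open>x\<close> and \<open>y\<close>, take an explicit
  \<open>w\<close> of order \<open>lcm m n = m * a = n * b\<close>. Then \<open>w ^ a\<close> is a
  power of \<open>x\<close> and \<open>w ^ b\<close> a power of \<open>y\<close>; since
  \<open>a\<close> and \<open>b\<close> are coprime, \<open>w\<close> can be recovered from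
  them.\<close>

lemma primitive_root_of_unity_lcm:
  assumes x: "primitive_root_of_unity m x" and y: "primitive_root_of_unity n y"
    and K: "complex_subfield K" "x \<in> K" "y \<in> K"
  obtains w where "w \<in> K" "primitive_root_of_unity (lcm m n) w"
proof -
  have mn: "m > 0" "n > 0" using x y by (auto simp: primitive_root_of_unity_def)
  define w where "w = cis (2 * pi / lcm m n)"
  have w: "primitive_root_of_unity (lcm m n) w"
    unfolding w_def by (rule primitive_root_of_unity_cis) (use mn in \<open>simp add: lcm_pos_nat\<close>)
  hence wl: "w ^ lcm m n = 1" and "w \<noteq> 0"
    using mn by (auto simp: primitive_root_of_unity_def power_0_left)
  obtain a where a: "lcm m n = m * a" using dvd_lcm1 by blast
  obtain b where b: "lcm m n = n * b" using dvd_lcm2 by blast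
  have ab: "a > 0" "b > 0" using a b mn by (metis lcm_pos_nat nat_0_less_mult_iff)+
  have "(w ^ a) ^ m = 1" using wl unfolding a by (simp add: mult.commute flip: power_mult)
  then obtain i where "w ^ a = x ^ i" using root_of_unity_is_power[OF x] by blast
  hence wa: "w ^ a \<in> K" using K complex_subfieldD(9) by simp
  have "(w ^ b) ^ n = 1" using wl unfolding b by (simp add: mult.commute flip: power_mult)
  then obtain j where "w ^ b = y ^ j" using root_of_unity_is_power[OF y] by blast
  hence wb: "w ^ b \<in> K" using K complex_subfieldD(9) by simp
  \<comment> \<open>A common factor of \<open>a\<close> and \<open>b\<close> could be divided out,
    leaving a smaller common multiple of \<open>m\<close> and \<open>n\<close>.\<close>
  have "gcd a b = 1"
  proof -
    obtain a' b' where a': "a = gcd a b * a'" and b': "b = gcd a b * b'"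
      by (meson gcd_dvd1 gcd_dvd2 dvdE)
    have "gcd a b * (m * a') = gcd a b * (n * b')"
      using a b a' b' by (metis mult.left_commute)
    hence "m * a' = n * b'" using ab by simp
    hence "lcm m n dvd m * a'" by (metis dvd_triv_left lcm_least)
    hence "a dvd a'" using mn unfolding a by simp
    hence "gcd a b * a' dvd 1 * a'" using a' by simp
    moreover have "a' \<noteq> 0" using a' ab by (metis mult_0_right less_numeral_extra(3))
    ultimately show ?thesis by (metis dvd_times_right_cancel_iff nat_dvd_1_iff_1)
  qed
  \<comment> \<open>Bezout over the naturals, which is why \<open>w\<close> appears as a quotient of
    powers.\<close>
  then obtain u v where "a * u = b * v + 1" using bezout_nat[of a b] ab by auto
  hence "(w ^ a) ^ u = (w ^ b) ^ v * w" by (simp flip: power_mult)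
  hence "w = (w ^ a) ^ u / (w ^ b) ^ v" using \<open>w \<noteq> 0\<close> by simp
  also have "\<dots> \<in> K" by (intro complex_subfieldD[OF K(1)] wa wb)
  finally show ?thesis using w that by blast
qed

lemma primitive_root_of_unity_Lcm:
  assumes "finite I" "complex_subfield K"
    and "\<And>i. i \<in> I \<Longrightarrow> primitive_root_of_unity (n i) (\<zeta> i)" "\<And>i. i \<in> I \<Longrightarrow> \<zeta> i \<in> K"
  obtains w where "w \<in> K" "primitive_root_of_unity (Lcm (n ` I)) w"
proof -
  have "\<exists>w\<in>K. primitive_root_of_unity (Lcm (n ` I)) w"
    using assms(1,3,4)
  proof (induction I rule: finite_induct)
    case empty
    show ?case using complex_subfieldD(1)[OF assms(2)]
      by (intro bexI[of _ 1]) (auto simp: primitive_root_of_unity_def)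
  next
    case (insert i I)
    then obtain w where w: "w \<in> K" "primitive_root_of_unity (Lcm (n ` I)) w" by blast
    obtain w' where "w' \<in> K" "primitive_root_of_unity (lcm (n i) (Lcm (n ` I))) w'"
      using primitive_root_of_unity_lcm[of "n i" "\<zeta> i", OF _ w(2) assms(2) _ w(1)] insert.prems by blast
    thus ?case by auto
  qed
  thus ?thesis using that by blast
qed

section \<open>Embeddings and generators; both groups in concrete terms\<close>

lemma field_embedding_ipoly:
  assumes K: "complex_subfield K" and h: "field_embedding K \<sigma>" and x: "x \<in> K"
  shows "\<sigma> (ipoly v x) = ipoly v (\<sigma> x)"
proof -
  note K' = complex_subfieldD[OF K] and h' = field_embeddingD[OF K h]
  have "ipoly v x \<in> K \<and> \<sigma> (ipoly v x) = ipoly v (\<sigma> x)"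
  proof (induction v)
    case (pCons a v)
    hence v: "ipoly v x \<in> K" by blast
    show ?case using K'(5)[OF K'(11) K'(6)[OF x v]] h'(3)[OF K'(11) K'(6)[OF x v]] h'(4)[OF x v]
      h'(10) pCons by simp
  qed (use K'(2) h'(2) in simp)
  thus ?thesis ..
qed

text \<open>The elements on which two embeddings agree form a subfield.\<close>

lemma field_embedding_unique:
  assumes "field_embedding (gen_field A) \<sigma>" "field_embedding (gen_field A) \<tau>"
    and "\<And>x. x \<in> A \<Longrightarrow> \<sigma> x = \<tau> x" and "x \<in> gen_field A"
  shows "\<sigma> x = \<tau> x"
proof -
  note K = complex_subfieldD[OF gen_field_subfield[of A]]
  note \<sigma> = field_embeddingD[OF gen_field_subfield assms(1)]
  note \<tau> = field_embeddingD[OF gen_field_subfield assms(2)]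
  have "complex_subfield {x \<in> gen_field A. \<sigma> x = \<tau> x}"
    unfolding complex_subfield_def by (auto simp: \<sigma>(1,3-6) \<tau>(1,3-6) intro: K(1,3-6))
  hence "gen_field A \<subseteq> {x \<in> gen_field A. \<sigma> x = \<tau> x}"
    by (rule gen_field_least) (use assms(3) gen_field_incl[of A] in auto)
  thus ?thesis using assms(4) by blast
qed

text \<open>For surjectivity: an image that contains the generators contains the field they
  generate.\<close>

lemma field_embedding_image_subfield:
  assumes K: "complex_subfield K" and h: "field_embedding K \<sigma>"
  shows "complex_subfield (\<sigma> ` K)"
proof -
  note K' = complex_subfieldD[OF K] and h' = field_embeddingD[OF K h]
  show ?thesis unfolding complex_subfield_def
  proof (intro conjI ballI)
    show "1 \<in> \<sigma> ` K" using K'(1) h'(1) by (metis imageI)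
    fix u assume "u \<in> \<sigma> ` K"
    then obtain x where x: "u = \<sigma> x" "x \<in> K" by blast
    show "- u \<in> \<sigma> ` K" "inverse u \<in> \<sigma> ` K"
      unfolding x(1) h'(5,6)[OF x(2), symmetric] using K'(3,4) x(2) by blast+
    fix v assume "v \<in> \<sigma> ` K"
    then obtain y where y: "v = \<sigma> y" "y \<in> K" by blast
    show "u + v \<in> \<sigma> ` K" "u * v \<in> \<sigma> ` K"
      unfolding x(1) y(1) h'(3,4)[OF x(2) y(2), symmetric] using K'(5,6) x(2) y(2) by blast+
  qed
qed

text \<open>Every embedding fixes \<rat>, which accounts for the condition on \<rat> in the Galois
  group.\<close>

lemma carrier_galois_group:
  assumes L: "gen_field (\<rat> \<union> A) = L"
  shows "carrier (galois_group (rat_adjoin A) \<rat>) =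
    {\<sigma>. field_embedding L \<sigma> \<and> \<sigma> \<in> extensional L \<and> bij_betw \<sigma> L L}" (is "?G = ?H")
proof -
  have sf: "complex_subfield L" unfolding L[symmetric] by (rule gen_field_subfield)
  have G: "\<sigma> \<in> ?G \<longleftrightarrow> \<sigma> \<in> L \<rightarrow> L \<and>
      (\<forall>x y. x \<in> L \<and> y \<in> L \<longrightarrow> \<sigma> (x * y) = \<sigma> x * \<sigma> y \<and> \<sigma> (x + y) = \<sigma> x + \<sigma> y) \<and> \<sigma> 1 = 1 \<and>
      bij_betw \<sigma> L L \<and> \<sigma> \<in> extensional L \<and> (\<forall>x\<in>\<rat>. \<sigma> x = x)" for \<sigma>
    by (simp add: galois_group_def rat_adjoin_def L ring_iso_def ring_hom_def Bij_def conj_ac)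
  have "\<sigma> \<in> ?G \<longleftrightarrow> \<sigma> \<in> ?H" for \<sigma>
  proof
    assume "\<sigma> \<in> ?G"
    thus "\<sigma> \<in> ?H" unfolding G mem_Collect_eq field_embedding_def by blast
  next
    assume *: "\<sigma> \<in> ?H"
    hence h: "field_embedding L \<sigma>" and b: "bij_betw \<sigma> L L" and e: "\<sigma> \<in> extensional L" by auto
    show "\<sigma> \<in> ?G"
      unfolding G using h bij_betw_imp_funcset[OF b] b e field_embeddingD(11)[OF sf h]
      unfolding field_embedding_def by blast
  qed
  thus ?thesis by blast
qed

lemma mult_galois_group:
  assumes L: "gen_field (\<rat> \<union> A) = L"
    and "\<sigma> \<in> carrier (galois_group (rat_adjoin A) \<rat>)" "\<tau> \<in> carrier (galois_group (rat_adjoin A) \<rat>)"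
  shows "\<sigma> \<otimes>\<^bsub>galois_group (rat_adjoin A) \<rat>\<^esub> \<tau> = compose L \<sigma> \<tau>"
  using assms(2,3) by (simp add: galois_group_def rat_adjoin_def L BijGroup_def)

lemma mem_carrier_D0_group:
  assumes d: "d > 1"
  shows "(f, \<theta>) \<in> carrier (D0_group d S) \<longleftrightarrow> 0 < f \<and> f < int d \<and> coprime f (int d) \<and>
    \<theta> \<in> S \<rightarrow>\<^sub>E {-1, 1} \<and> (\<forall>T\<in>D0_sets d S. (\<Prod>s\<in>T. \<theta> s) * Jacobi (sqf_set T) f = 1)"
proof -
  interpret residues "int d" "residue_ring (int d)"
    using d by unfold_locales simp_all
  show ?thesis
    by (simp add: D0_group_def F_group_def Let_def sign_img_def units_of_def res_units_eq)
qed

lemma mult_D0_group: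
  "(f, \<theta>) \<otimes>\<^bsub>D0_group d S\<^esub> (g, \<eta>) = (f * g mod int d, \<lambda>a\<in>S. \<theta> a * \<eta> a)"
  by (simp add: D0_group_def F_group_def Let_def sign_img_def units_of_def residue_ring_def)

section \<open>Coordinates of automorphisms and the isomorphism\<close>

context kummer_extension
begin

definition L :: "complex set" where
  "L = gen_field (r ` S \<union> insert z \<rat>)"

definition automorphisms :: "(complex \<Rightarrow> complex) set" where
  "automorphisms = {\<sigma>. field_embedding L \<sigma> \<and> \<sigma> \<in> extensional L \<and> bij_betw \<sigma> L L}"

text \<open>The graph of the isomorphism as a relation. Existence and uniqueness are shown in both
  directions, and compatibility with the products separately.\<close>

definition has_coordinates :: "(complex \<Rightarrow> complex) \<Rightarrow> int \<times> (int \<Rightarrow> int) \<Rightarrow> bool" where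
  "has_coordinates \<sigma> x \<longleftrightarrow> \<sigma> z = z ^ nat (fst x) \<and> (\<forall>a\<in>S. \<sigma> (r a) = of_int (snd x a) * r a)"

lemma z_in_L: "z \<in> L"
  unfolding L_def by (rule subsetD[OF gen_field_incl]) simp

lemma r_in_L: "a \<in> S \<Longrightarrow> r a \<in> L"
  unfolding L_def by (rule subsetD[OF gen_field_incl]) simp

lemma L_subfield: "complex_subfield L"
  unfolding L_def by (rule gen_field_subfield)

lemma L_least:
  assumes "complex_subfield K" "z \<in> K" "\<And>a. a \<in> S \<Longrightarrow> r a \<in> K"
  shows "L \<subseteq> K"
  unfolding L_def by (rule gen_field_least[OF assms(1)]) (use assms complex_subfield_Rats[OF assms(1)] in auto)

lemma automorphism_unique:
  assumes "\<sigma> \<in> automorphisms" "\<tau> \<in> automorphisms" "has_coordinates \<sigma> x" "has_coordinates \<tau> x"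
  shows "\<sigma> = \<tau>"
proof (rule extensionalityI)
  show "\<sigma> \<in> extensional L" "\<tau> \<in> extensional L" using assms by (auto simp: automorphisms_def)
  have emb: "field_embedding L \<sigma>" "field_embedding L \<tau>" using assms by (auto simp: automorphisms_def)
  fix x assume "x \<in> L"
  thus "\<sigma> x = \<tau> x"
  proof (rule field_embedding_unique[OF emb[unfolded L_def], folded L_def, rotated])
    fix y assume "y \<in> r ` S \<union> insert z \<rat>"
    thus "\<sigma> y = \<tau> y" using assms(3,4)
      field_embeddingD(11)[OF L_subfield emb(1)] field_embeddingD(11)[OF L_subfield emb(2)]
      by (auto simp: has_coordinates_def)
  qed
qed

text \<open>The embedding maps generators into \<open>L\<close>. It is onto because
  \<open>z ^ m\<close>, with \<open>m\<close> inverse to the exponent modulo \<open>d\<close>, is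
  sent to \<open>z\<close>, and \<open>\<theta> a * r a\<close> is sent to
  \<open>r a\<close>.\<close>

lemma automorphism_exists:
  assumes x: "x \<in> carrier (D0_group d S)"
  obtains \<sigma> where "\<sigma> \<in> automorphisms" "has_coordinates \<sigma> x"
proof -
  obtain f \<theta> where f\<theta>: "x = (f, \<theta>)" by fastforce
  have "d \<ge> 8" using d8 d_pos by (auto dest: dvd_imp_le)
  hence "d > 1" by simp
  note x' = x[unfolded f\<theta> mem_carrier_D0_group[OF \<open>d > 1\<close>]]
  define n where "n = nat f"
  have f: "f = int n" and n: "n > 0" "coprime n d" using x' by (auto simp: n_def coprime_int_iff[symmetric])
  have \<theta>: "\<theta> a \<in> {1, -1}" if "a \<in> S" for a using x' that by (auto dest: PiE_mem)
  have "(\<Prod>a\<in>U. \<theta> a) * Jacobi (sqf_set U) (int n) = 1" if "U \<in> D0_sets d S" for U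
    using x' that unfolding f by simp
  from embedding_exists[OF n(2,1) \<theta> this, folded L_def]
  obtain \<sigma> where \<sigma>: "field_embedding L \<sigma>" "\<sigma> z = z ^ n"
    "\<And>a. a \<in> S \<Longrightarrow> \<sigma> (r a) = of_int (\<theta> a) * r a" by blast
  note K = complex_subfieldD[OF L_subfield] and hom = field_embeddingD[OF L_subfield \<sigma>(1)]
  have image: "complex_subfield (\<sigma> ` L)" by (rule field_embedding_image_subfield[OF L_subfield \<sigma>(1)])
  note I = complex_subfieldD[OF image]
  have "\<sigma> ` L \<subseteq> L"
  proof -
    have "complex_subfield {x \<in> L. \<sigma> x \<in> L}"
      unfolding complex_subfield_def by (auto simp: hom(1,3-6) intro: K(1,3-6))
    moreover have "\<sigma> z \<in> L" unfolding \<sigma>(2) by (rule K(9)[OF z_in_L])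
    moreover have "\<sigma> (r a) \<in> L" if "a \<in> S" for a
      unfolding \<sigma>(3)[OF that] by (rule K(6)[OF K(11) r_in_L[OF that]])
    ultimately have "L \<subseteq> {x \<in> L. \<sigma> x \<in> L}"
      using z_in_L r_in_L by (intro L_least) simp_all
    thus ?thesis by blast
  qed
  moreover have "L \<subseteq> \<sigma> ` L"
  proof (rule L_least[OF image])
    obtain m where "[n * m = Suc 0] (mod d)" using cong_solve_coprime_nat[OF n(2)] by blast
    hence "n * m mod d = 1" using \<open>d > 1\<close> by (simp add: cong_def)
    then obtain q where nm: "n * m = d * q + 1" using mult_div_mod_eq[of d "n * m"] by metis
    have "z ^ (n * m) = z" unfolding nm by (simp add: power_add power_mult z_pow)
    hence "\<sigma> (z ^ m) = z"
      unfolding hom(8)[OF z_in_L] \<sigma>(2) by (simp add: z_pow flip: power_mult)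
    thus "z \<in> \<sigma> ` L" by (rule image_eqI[OF sym K(9)[OF z_in_L]])
    fix a assume a: "a \<in> S"
    have "\<sigma> (of_int (\<theta> a) * r a) = r a"
      unfolding hom(4)[OF K(11) r_in_L[OF a]] hom(10) \<sigma>(3)[OF a] using \<theta>[OF a] by auto
    thus "r a \<in> \<sigma> ` L" by (rule image_eqI[OF sym K(6)[OF K(11) r_in_L[OF a]]])
  qed
  ultimately have bij: "bij_betw \<sigma> L L"
    using field_embedding_inj[OF L_subfield \<sigma>(1)] by (auto simp: bij_betw_def)
  \<comment> \<open>Elements of the Galois group are extensional, so the values outside
    \<open>L\<close> are cut off.\<close>
  define \<tau> where "\<tau> = restrict \<sigma> L"
  have \<tau>: "\<tau> u = \<sigma> u" if "u \<in> L" for u using that by (simp add: \<tau>_def)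
  have "field_embedding L \<tau>"
    unfolding field_embedding_def
  proof (intro conjI ballI)
    show "\<tau> 1 = 1" using \<tau>[OF K(1)] hom(1) by simp
    fix u v assume uv: "u \<in> L" "v \<in> L"
    show "\<tau> (u + v) = \<tau> u + \<tau> v" "\<tau> (u * v) = \<tau> u * \<tau> v"
      unfolding \<tau>[OF uv(1)] \<tau>[OF uv(2)] \<tau>[OF K(5)[OF uv]] \<tau>[OF K(6)[OF uv]]
      by (rule hom(3)[OF uv], rule hom(4)[OF uv])
  qed
  moreover have "bij_betw \<tau> L L" using bij \<tau> by (subst bij_betw_cong[of L \<tau> \<sigma>]) auto
  moreover have "has_coordinates \<tau> x"
    unfolding has_coordinates_def f\<theta> fst_conv snd_conv \<tau>[OF z_in_L]
    using \<tau>[OF r_in_L] \<sigma>(2,3) by (simp add: n_def)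
  moreover have "\<tau> \<in> extensional L" by (simp add: \<tau>_def)
  ultimately show ?thesis using that[of \<tau>] by (simp add: automorphisms_def)
qed

text \<open>An automorphism sends \<open>z\<close> to a \<open>d\<close>-th root of unity and each
  \<open>r a\<close> to itself or its negative. For \<open>U\<close> in \<open>D0_sets d S\<close>
  the image of the product of roots is computed once from the signs and once from the conjugate of
  \<open>z\<close>; the product is non-zero, so the sign product equals the Jacobi symbol.\<close>

lemma coordinates_exist:
  assumes \<sigma>: "\<sigma> \<in> automorphisms"
  obtains x where "x \<in> carrier (D0_group d S)" "has_coordinates \<sigma> x"
proof -
  have emb: "field_embedding L \<sigma>" using \<sigma> by (auto simp: automorphisms_def)
  note K = complex_subfieldD[OF L_subfield] and hom = field_embeddingD[OF L_subfield emb]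
  have "d \<ge> 8" using d8 d_pos by (auto dest: dvd_imp_le)
  hence d1: "d > 1" by simp
  have "\<sigma> z ^ d = 1" using hom(8)[OF z_in_L, of d] z_pow hom(1) by simp
  then obtain n where n: "n < d" "\<sigma> z = z ^ n" using root_of_unity_is_power[OF prim] by blast
  have cop: "coprime n d"
  proof (rule ccontr)
    assume "\<not> coprime n d"
    \<comment> \<open>With \<open>m = d / g\<close> the automorphism sends both \<open>z ^ m\<close>
      and 1 to 1, against injectivity, since \<open>z ^ m\<close> differs from 1.\<close>
    define g where "g = gcd n d"
    have "g \<noteq> 1" using \<open>\<not> coprime n d\<close> unfolding g_def coprime_iff_gcd_eq_1 .
    have "g \<noteq> 0" using d_pos by (simp add: g_def)
    obtain m where m: "d = g * m" unfolding g_def by (meson gcd_dvd2 dvdE)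
    obtain k where k: "n = g * k" unfolding g_def by (meson gcd_dvd1 dvdE)
    have "m > 0" using m d_pos by simp
    moreover have "m < d" using \<open>m > 0\<close> \<open>g \<noteq> 1\<close> \<open>g \<noteq> 0\<close> unfolding m by simp
    ultimately have "z ^ m \<noteq> 1" using prim by (auto simp: primitive_root_of_unity_def)
    moreover have "z ^ m = 1"
    proof (rule inj_onD[OF field_embedding_inj[OF L_subfield emb]])
      have "n * m = d * k" unfolding m k by simp
      hence "(z ^ n) ^ m = (z ^ d) ^ k" by (metis power_mult)
      thus "\<sigma> (z ^ m) = \<sigma> 1" unfolding hom(8)[OF z_in_L] hom(1) n(2) by (simp add: z_pow)
    qed (rule K(9)[OF z_in_L], rule K(1))
    ultimately show False by blast
  qed
  have n0: "n > 0" using cop d1 by (cases n) auto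
  define \<theta> :: "int \<Rightarrow> int" where "\<theta> = (\<lambda>a\<in>S. if \<sigma> (r a) = r a then 1 else -1)"
  have \<theta>: "\<sigma> (r a) = of_int (\<theta> a) * r a" if a: "a \<in> S" for a
  proof -
    have "(\<sigma> (r a))\<^sup>2 = (r a)\<^sup>2"
      using hom(8)[OF r_in_L[OF a], of 2] r_square[OF a] hom(10) by simp
    hence "\<sigma> (r a) = r a \<or> \<sigma> (r a) = - r a" by (simp add: power2_eq_iff)
    thus ?thesis using a by (auto simp: \<theta>_def)
  qed
  have "(\<Prod>a\<in>U. \<theta> a) * Jacobi (sqf_set U) (int n) = 1" if U: "U \<in> D0_sets d S" for U
  proof -
    have US: "U \<subseteq> S" using U by (auto simp: D0_sets_def)
    obtain v where v: "(\<Prod>a\<in>U. r a) = ipoly v z"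
      "ipoly v (z ^ n) = of_int (Jacobi (sqf_set U) (int n)) * ipoly v z"
      using D0_sets_conjugate[OF U] cop n0 by blast
    have "\<sigma> (\<Prod>a\<in>U. r a) = (\<Prod>a\<in>U. \<sigma> (r a))"
      by (rule field_embedding_prod[OF L_subfield emb r_in_L]) (use US in blast)
    also have "\<dots> = (\<Prod>a\<in>U. of_int (\<theta> a) * r a)"
      by (rule prod.cong) (use \<theta> US in auto)
    also have "\<dots> = of_int (\<Prod>a\<in>U. \<theta> a) * (\<Prod>a\<in>U. r a)" by (simp add: prod.distrib)
    finally have 1: "\<sigma> (ipoly v z) = of_int (\<Prod>a\<in>U. \<theta> a) * ipoly v z" unfolding v(1) .
    have 2: "\<sigma> (ipoly v z) = of_int (Jacobi (sqf_set U) (int n)) * ipoly v z"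
      unfolding field_embedding_ipoly[OF L_subfield emb z_in_L] n(2) by (rule v(2))
    have "ipoly v z \<noteq> 0" unfolding v(1)[symmetric]
      using r_nonzero US finite_subset[OF US S(1)] by auto
    hence 3: "Jacobi (sqf_set U) (int n) = (\<Prod>a\<in>U. \<theta> a)" using 1 2 by (simp del: of_int_prod)
    have "(\<Prod>a\<in>U. \<theta> a) * (\<Prod>a\<in>U. \<theta> a) = (\<Prod>a\<in>U. \<theta> a * \<theta> a)" by (rule prod.distrib[symmetric])
    also have "\<dots> = 1" by (rule prod.neutral) (use US in \<open>auto simp: \<theta>_def\<close>)
    finally show ?thesis unfolding 3 .
  qed
  moreover have "\<theta> \<in> S \<rightarrow>\<^sub>E {-1, 1}" by (auto simp: \<theta>_def)
  ultimately have "(int n, \<theta>) \<in> carrier (D0_group d S)"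
    unfolding mem_carrier_D0_group[OF d1] using n n0 cop by (simp add: coprime_int_iff)
  moreover have "has_coordinates \<sigma> (int n, \<theta>)"
    using n(2) \<theta> by (simp add: has_coordinates_def)
  ultimately show ?thesis using that by blast
qed

lemma compose_automorphisms:
  assumes "\<sigma> \<in> automorphisms" "\<tau> \<in> automorphisms"
  shows "compose L \<sigma> \<tau> \<in> automorphisms"
proof -
  note K = complex_subfieldD[OF L_subfield]
  have e: "field_embedding L \<sigma>" "field_embedding L \<tau>" and b: "bij_betw \<sigma> L L" "bij_betw \<tau> L L"
    using assms by (auto simp: automorphisms_def)
  note \<sigma> = field_embeddingD[OF L_subfield e(1)] and \<tau> = field_embeddingD[OF L_subfield e(2)]
  have in_L: "\<tau> u \<in> L" if "u \<in> L" for u using b(2) that by (auto simp: bij_betw_def)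
  have c: "compose L \<sigma> \<tau> u = \<sigma> (\<tau> u)" if "u \<in> L" for u using that by (simp add: compose_def)
  have "field_embedding L (compose L \<sigma> \<tau>)"
    unfolding field_embedding_def
  proof (intro conjI ballI)
    show "compose L \<sigma> \<tau> 1 = 1" unfolding c[OF K(1)] using \<sigma>(1) \<tau>(1) by simp
    fix u v assume uv: "u \<in> L" "v \<in> L"
    show "compose L \<sigma> \<tau> (u + v) = compose L \<sigma> \<tau> u + compose L \<sigma> \<tau> v"
      "compose L \<sigma> \<tau> (u * v) = compose L \<sigma> \<tau> u * compose L \<sigma> \<tau> v"
      unfolding c[OF uv(1)] c[OF uv(2)] c[OF K(5)[OF uv]] c[OF K(6)[OF uv]] \<tau>(3)[OF uv] \<tau>(4)[OF uv]
      by (rule \<sigma>(3)[OF in_L[OF uv(1)] in_L[OF uv(2)]], rule \<sigma>(4)[OF in_L[OF uv(1)] in_L[OF uv(2)]])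
  qed
  moreover have "bij_betw (compose L \<sigma> \<tau>) L L" using b by (rule bij_betw_compose[rotated])
  ultimately show ?thesis by (simp add: automorphisms_def)
qed

text \<open>An automorphism fixes the integers \<open>\<eta> a\<close>, so signs multiply; exponents
  of \<open>z\<close> multiply and count only modulo \<open>d\<close>.\<close>

lemma compose_has_coordinates:
  assumes "\<sigma> \<in> automorphisms" "\<tau> \<in> automorphisms"
    and x: "has_coordinates \<sigma> x" "x \<in> carrier (D0_group d S)"
    and y: "has_coordinates \<tau> y" "y \<in> carrier (D0_group d S)"
  shows "has_coordinates (compose L \<sigma> \<tau>) (x \<otimes>\<^bsub>D0_group d S\<^esub> y)"
proof -
  obtain f \<theta> g \<eta> where xy: "x = (f, \<theta>)" "y = (g, \<eta>)" by fastforce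
  have e: "field_embedding L \<sigma>" using assms by (auto simp: automorphisms_def)
  note K = complex_subfieldD[OF L_subfield] and \<sigma> = field_embeddingD[OF L_subfield e]
  have "d \<ge> 8" using d8 d_pos by (auto dest: dvd_imp_le)
  hence d1: "d > 1" by simp
  have pos: "f > 0" "g > 0" using x(2) y(2) unfolding xy mem_carrier_D0_group[OF d1] by auto
  have "compose L \<sigma> \<tau> z = z ^ nat (f * g mod int d)"
  proof -
    have "compose L \<sigma> \<tau> z = \<sigma> (z ^ nat g)"
      using y(1) z_in_L by (simp add: compose_def has_coordinates_def xy)
    also have "\<dots> = (z ^ nat f) ^ nat g"
      unfolding \<sigma>(8)[OF z_in_L] using x(1) by (simp add: has_coordinates_def xy)
    also have "\<dots> = z ^ (nat f * nat g)" by (simp add: power_mult)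
    also have "nat f * nat g = d * (nat f * nat g div d) + nat f * nat g mod d" by simp
    also have "z ^ \<dots> = (z ^ d) ^ (nat f * nat g div d) * z ^ (nat f * nat g mod d)"
      by (simp only: power_add power_mult)
    also have "nat f * nat g mod d = nat (f * g mod int d)"
      using pos by (simp add: nat_mod_distrib nat_mult_distrib)
    finally show ?thesis by (simp add: z_pow)
  qed
  moreover have "compose L \<sigma> \<tau> (r a) = of_int (\<theta> a * \<eta> a) * r a" if a: "a \<in> S" for a
  proof -
    have "compose L \<sigma> \<tau> (r a) = \<sigma> (of_int (\<eta> a) * r a)"
      using y(1) r_in_L[OF a] a by (simp add: compose_def has_coordinates_def xy)
    also have "\<dots> = of_int (\<eta> a) * \<sigma> (r a)"
      unfolding \<sigma>(4)[OF K(11) r_in_L[OF a]] \<sigma>(10) ..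
    finally show ?thesis using x(1) a by (simp add: has_coordinates_def xy)
  qed
  ultimately show ?thesis by (simp add: has_coordinates_def xy mult_D0_group)
qed

lemma coordinates_unique:
  assumes x: "x \<in> carrier (D0_group d S)" "has_coordinates \<sigma> x"
    and y: "y \<in> carrier (D0_group d S)" "has_coordinates \<sigma> y"
  shows "x = y"
proof -
  obtain f \<theta> g \<eta> where xy: "x = (f, \<theta>)" "y = (g, \<eta>)" by fastforce
  have "d \<ge> 8" using d8 d_pos by (auto dest: dvd_imp_le)
  hence d1: "d > 1" by simp
  note x' = x(1)[unfolded xy mem_carrier_D0_group[OF d1]] and y' = y(1)[unfolded xy mem_carrier_D0_group[OF d1]]
  have "z ^ nat f = z ^ nat g" using x(2) y(2) by (simp add: has_coordinates_def xy)
  hence "nat f = nat g"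
    by (rule inj_onD[OF root_of_unity_powers_inj[OF prim]]) (use x' y' in auto)
  moreover have "f > 0" "g > 0" using x' y' by blast+
  ultimately have "f = g" by simp
  moreover have "\<theta> = \<eta>"
  proof (rule PiE_ext)
    show "\<theta> \<in> S \<rightarrow>\<^sub>E {-1, 1}" "\<eta> \<in> S \<rightarrow>\<^sub>E {-1, 1}" using x' y' by auto
    fix a assume a: "a \<in> S"
    hence "of_int (\<theta> a) * r a = of_int (\<eta> a) * r a" using x(2) y(2) by (simp add: has_coordinates_def xy)
    thus "\<theta> a = \<eta> a" using r_nonzero[OF a] by simp
  qed
  ultimately show ?thesis by (simp add: xy)
qed

text \<open>The generating set \<open>A\<close> is left open because the theorem presents the field
  by several roots of unity, whereas \<open>L\<close> is built from the single
  \<open>z\<close>.\<close>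

lemma D0_group_iso:
  assumes L: "gen_field (\<rat> \<union> A) = L"
  obtains \<Phi> where "\<Phi> \<in> iso (D0_group d S) (galois_group (rat_adjoin A) \<rat>)"
    "\<And>x. x \<in> carrier (D0_group d S) \<Longrightarrow> has_coordinates (\<Phi> x) x"
    "\<And>x. x \<in> carrier (D0_group d S) \<Longrightarrow> field_embedding L (\<Phi> x)"
proof -
  let ?D = "D0_group d S" and ?G = "galois_group (rat_adjoin A) \<rat>"
  have G: "carrier ?G = automorphisms"
    unfolding automorphisms_def by (rule carrier_galois_group[OF L])
  define \<Phi> where "\<Phi> x = (THE \<sigma>. \<sigma> \<in> automorphisms \<and> has_coordinates \<sigma> x)" for x
  have eq: "\<Phi> x = \<sigma>" if "\<sigma> \<in> automorphisms" "has_coordinates \<sigma> x" for x \<sigma>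
    unfolding \<Phi>_def
    by (rule the_equality) (use that automorphism_unique in blast)+
  have \<Phi>: "\<Phi> x \<in> automorphisms" "has_coordinates (\<Phi> x) x" if x: "x \<in> carrier ?D" for x
  proof -
    obtain \<sigma> where \<sigma>: "\<sigma> \<in> automorphisms" "has_coordinates \<sigma> x" using automorphism_exists[OF x] by blast
    show "\<Phi> x \<in> automorphisms" "has_coordinates (\<Phi> x) x" unfolding eq[OF \<sigma>] by (fact \<sigma>)+
  qed
  have "\<Phi> (x \<otimes>\<^bsub>?D\<^esub> y) = \<Phi> x \<otimes>\<^bsub>?G\<^esub> \<Phi> y" if xy: "x \<in> carrier ?D" "y \<in> carrier ?D" for x y
  proof -
    have "\<Phi> x \<otimes>\<^bsub>?G\<^esub> \<Phi> y = compose L (\<Phi> x) (\<Phi> y)"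
      by (rule mult_galois_group[OF L]) (simp_all add: G \<Phi> xy)
    moreover have "\<Phi> (x \<otimes>\<^bsub>?D\<^esub> y) = compose L (\<Phi> x) (\<Phi> y)"
      by (intro eq compose_automorphisms compose_has_coordinates \<Phi> xy)
    ultimately show ?thesis by simp
  qed
  hence "\<Phi> \<in> hom ?D ?G" by (auto intro!: homI simp: G \<Phi>)
  moreover have "bij_betw \<Phi> (carrier ?D) (carrier ?G)"
    unfolding bij_betw_def G
  proof (intro conjI equalityI subsetI)
    show "inj_on \<Phi> (carrier ?D)"
    proof (rule inj_onI)
      fix x y assume "x \<in> carrier ?D" "y \<in> carrier ?D" "\<Phi> x = \<Phi> y"
      thus "x = y" using coordinates_unique \<Phi>(2) by metis
    qed
    show "\<sigma> \<in> automorphisms" if "\<sigma> \<in> \<Phi> ` carrier ?D" for \<sigma> using that \<Phi>(1) by blast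
    show "\<sigma> \<in> \<Phi> ` carrier ?D" if \<sigma>: "\<sigma> \<in> automorphisms" for \<sigma>
    proof -
      obtain x where x: "x \<in> carrier ?D" "has_coordinates \<sigma> x" using coordinates_exist[OF \<sigma>] by blast
      thus ?thesis using eq[OF \<sigma>] by blast
    qed
  qed
  ultimately have "\<Phi> \<in> iso ?D ?G" by (simp add: iso_def)
  moreover have "field_embedding L (\<Phi> x)" if "x \<in> carrier ?D" for x
    using \<Phi>(1)[OF that] by (auto simp: automorphisms_def)
  ultimately show ?thesis using that \<Phi>(2) by blast
qed

end

section \<open>The isomorphism for the given generators\<close>

theorem corollary7p1:
  fixes S :: "int set" and k d :: nat and ds :: "nat \<Rightarrow> nat"
    and r :: "int \<Rightarrow> complex" and \<zeta> :: "nat \<Rightarrow> complex"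
  assumes "finite S" and "0 \<notin> S"
    and "\<And>i. i \<in> {1..k} \<Longrightarrow> 3 \<le> ds i"
    and "mono_on {1..k} ds"
    and "d = Lcm (ds ` {1..k})"
    and "8 dvd d"
    and "\<And>a. a \<in> S \<Longrightarrow> (r a)\<^sup>2 = of_int a"
    and "\<And>i. i \<in> {1..k} \<Longrightarrow> primitive_root_of_unity (ds i) (\<zeta> i)"
  shows "\<exists>\<Phi> \<in> iso (D0_group d S) (galois_group (rat_adjoin (r ` S \<union> \<zeta> ` {1..k})) \<rat>).
           \<forall>(f, \<theta>) \<in> carrier (D0_group d S).
             (\<forall>a\<in>S. \<Phi> (f, \<theta>) (r a) = of_int (\<theta> a) * r a) \<and>
             (\<forall>i\<in>{1..k}. \<Phi> (f, \<theta>) (\<zeta> i) = \<zeta> i powi f)"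
proof -
  let ?A = "r ` S \<union> \<zeta> ` {1..k}"
  have incl: "u \<in> gen_field (\<rat> \<union> ?A)" if "u \<in> \<rat> \<union> ?A" for u
    using subsetD[OF gen_field_incl that] .
  have "\<zeta> i \<in> gen_field (\<rat> \<union> ?A)" if "i \<in> {1..k}" for i
    by (rule incl) (use that in blast)
  \<comment> \<open>A single root of order \<open>d\<close> inside the field takes the place of all
    the \<open>\<zeta> i\<close>.\<close>
  from primitive_root_of_unity_Lcm[of "{1..k}" _ ds \<zeta>, OF finite_atLeastAtMost gen_field_subfield assms(8) this]
  obtain z where z: "z \<in> gen_field (\<rat> \<union> ?A)" "primitive_root_of_unity d z"
    unfolding assms(5) by blast
  interpret kummer_extension z d S r
    by unfold_locales (fact z(2) assms)+
  have \<zeta>_power: "\<exists>j. \<zeta> i = z ^ j" if i: "i \<in> {1..k}" for i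
  proof -
    have "ds i dvd d" unfolding assms(5) using i by (intro dvd_Lcm) blast
    then obtain m where m: "d = ds i * m" by blast
    have "\<zeta> i ^ ds i = 1" using assms(8)[OF i] by (simp add: primitive_root_of_unity_def)
    hence "\<zeta> i ^ d = 1" unfolding m power_mult by simp
    thus ?thesis using root_of_unity_is_power[OF prim] by blast
  qed
  have L: "gen_field (\<rat> \<union> ?A) = L"
  proof
    show "gen_field (\<rat> \<union> ?A) \<subseteq> L"
    proof (rule gen_field_least[OF L_subfield])
      have "\<zeta> i \<in> L" if "i \<in> {1..k}" for i
        using \<zeta>_power[OF that] complex_subfieldD(9)[OF L_subfield z_in_L] by auto
      thus "\<rat> \<union> ?A \<subseteq> L"
        using complex_subfield_Rats[OF L_subfield] r_in_L by blast
    qed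
    show "L \<subseteq> gen_field (\<rat> \<union> ?A)"
      by (rule L_least[OF gen_field_subfield z(1)]) (rule incl, blast)
  qed
  obtain \<Phi> where \<Phi>: "\<Phi> \<in> iso (D0_group d S) (galois_group (rat_adjoin ?A) \<rat>)"
    "\<And>x. x \<in> carrier (D0_group d S) \<Longrightarrow> has_coordinates (\<Phi> x) x"
    "\<And>x. x \<in> carrier (D0_group d S) \<Longrightarrow> field_embedding L (\<Phi> x)"
    using D0_group_iso[OF L] by blast
  have "d \<ge> 8" using d8 d_pos by (auto dest: dvd_imp_le)
  hence d1: "d > 1" by simp
  \<comment> \<open>Every \<open>\<zeta> i\<close> is a power of \<open>z\<close>, so it is raised
    to the same exponent \<open>f\<close>; the formula does not depend on the choice of
    \<open>z\<close>.\<close>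
  have "\<Phi> (f, \<theta>) (\<zeta> i) = \<zeta> i powi f" if f: "(f, \<theta>) \<in> carrier (D0_group d S)" and i: "i \<in> {1..k}" for f \<theta> i
  proof -
    obtain j where j: "\<zeta> i = z ^ j" using \<zeta>_power[OF i] by blast
    have "f > 0" using f unfolding mem_carrier_D0_group[OF d1] by blast
    have "\<Phi> (f, \<theta>) (\<zeta> i) = \<Phi> (f, \<theta>) z ^ j"
      unfolding j by (rule field_embeddingD(8)[OF L_subfield \<Phi>(3)[OF f] z_in_L])
    also have "\<dots> = \<zeta> i ^ nat f"
      using \<Phi>(2)[OF f] unfolding has_coordinates_def j by (simp add: mult.commute flip: power_mult)
    finally show ?thesis using \<open>f > 0\<close> by (simp add: power_int_def)
  qed
  moreover have "\<Phi> (f, \<theta>) (r a) = of_int (\<theta> a) * r a"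
    if "(f, \<theta>) \<in> carrier (D0_group d S)" "a \<in> S" for f \<theta> a
    using \<Phi>(2)[OF that(1)] that(2) by (simp add: has_coordinates_def)
  ultimately show ?thesis using \<Phi>(1) by (intro bexI[of _ \<Phi>]) auto
qed

end
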